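(* Let $\{\mu_i(x): i\in[n_1]\}$ and $\{v_j(y): j\in[n_2]\}$ be two blending basis sequences on $[0,1]$, let $x_0<\cdots<x_m$ and $y_0<\cdots<y_p$ be real increasing sequences in $[0,1]$, let $\boldsymbol Q_{hl}\in\mathbb R^3$ ($h\in[m]$, $l\in[p]$) be data points, $\lambda\ge0$, $\{U_i\}_{i=0}^t$ a partition of $[n_1]$, $\{V_j\}_{j=0}^s$ a partition of $[n_2]$, and let $\hat{\boldsymbol A}$, $\hat{\boldsymbol B}$ be the corresponding augmented collocation matrices and $\hat{\boldsymbol Q}$ the augmented data, as defined in the context. Suppose that $\hat{\boldsymbol A}$ and $\hat{\boldsymbol B}$ have full column rank and that the number of data points is larger than the number of control points (i.e. $(m+1)(p+1)>(n_1+1)(n_2+1)$). Then, for arbitrary initial control points $\boldsymbol P^{(0)}_{ij}\in\mathbb R^3$, the sequence of fitting surfaces $\mathcal S^{(k)}$ generated by the regularized RPIA algorithm for surfaces converges in expectation to the least-squares fitting solution: if for each coordinate $f\in\{1,2,3\}$ $$\boldsymbol P^*_{(f)}=(\hat{\boldsymbol A}^T\hat{\boldsymbol A})^{-1}\hat{\boldsymbol A}^T\hat{\boldsymbol Q}_{(f)}\hat{\boldsymbol B}(\hat{\boldsymbol B}^T\hat{\boldsymbol B})^{-1}$$ denotes the minimizer of $\|\hat{\boldsymbol A}\boldsymbol P\hat{\boldsymbol B}^T-\hat{\boldsymbol Q}_{(f)}\|_F^2$ over $\boldsymbol P\in\mathbb R^{(n_1+1)\times(n_2+1)}$, then $$\lim_{k\to\infty}\mathbb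 E[\boldsymbol P^{(k)}_{(f)}]=\boldsymbol P^*_{(f)},\qquad f=1,2,3,$$ and hence $\lim_{k\to\infty}\mathbb E[\mathcal S^{(k)}(x,y)]=\sum_{i=0}^{n_1}\sum_{j=0}^{n_2}\mu_i(x)v_j(y)\boldsymbol P^*_{ij}$ for every $x\in[x_0,x_m]$, $y\in[y_0,y_p]$.
   Context: Notation: $[n]=\{0,1,\dots,n\}$. A partition $\{U_i\}_{i=0}^t$ of $[n_1]$ consists of pairwise disjoint nonempty sets with union $[n_1]$ (similarly for $[n_2]$). For a matrix $\boldsymbol M$ and index sets $U,V$, $\boldsymbol M_{:,U}$ is the submatrix of columns indexed by $U$ and $\boldsymbol M_{U,V}$ the submatrix with rows in $U$ and columns in $V$; $\|\cdot\|_F$ is the Frobenius norm. A blending basis sequence here is a finite sequence of real-valued functions on $[0,1]$ (no further property is specified). Data points and control points lie in $\mathbb R^3$; the subscript $(f)$, $f=1,2,3$, denotes the matrix of $f$-th coordinates, e.g. $\boldsymbol Q_{(f)}\in\mathbb R^{(m+1)\times(p+1)}$, $\boldsymbol P_{(f)}\in\mathbb R^{(n_1+1)\times(n_2+1)}$. Matrix formulas below without $(f)$ are applied to each coordinate slice separately. Augmented matrices: $\boldsymbol A\in\mathbb R^{(m+1)\times(n_1+1)}$ and $\boldsymbol B\in\mathbb R^{(p+1)\times(n_2+1)}$ are the collocation (design) matrices with entries $\boldsymbol A_{h,i}=\mu_i(x_h)$, $\boldsymbol B_{l,j}=v_j(y_l)$. $\boldsymbol L_u\in\mathbb R^{(n_1+1)\times(n_1+1)}$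 and $\boldsymbol L_v\in\mathbb R^{(n_2+1)\times(n_2+1)}$ are second-order difference matrices: there is a constant $C>0$ such that each row other than the first and last, say row $i$, maps a vector $p$ to $C(p_{i-1}-2p_i+p_{i+1})$, while the first and last rows encode fixed boundary conditions, otherwise unspecified. With regularization parameter $\lambda$, $$\hat{\boldsymbol A}=\begin{bmatrix}\boldsymbol A\\ \sqrt\lambda\,\boldsymbol L_u\end{bmatrix},\quad \hat{\boldsymbol B}=\begin{bmatrix}\boldsymbol B\\ \sqrt\lambda\,\boldsymbol L_v\end{bmatrix},\quad \hat{\boldsymbol Q}=\begin{bmatrix}\boldsymbol Q&\boldsymbol 0\\ \boldsymbol 0&\boldsymbol 0\end{bmatrix},$$ where $\hat{\boldsymbol Q}$ has as many rows as $\hat{\boldsymbol A}$ and as many columns as $\hat{\boldsymbol B}$ has rows. Regularized RPIA algorithm for surfaces: start from (deterministic) control points $\boldsymbol P^{(0)}$. For $k=0,1,2,\dots$, the $k$-th surface is $\mathcal S^{(k)}(x,y)=\sum_{i=0}^{n_1}\sum_{j=0}^{n_2}\mu_i(x)v_j(y)\boldsymbol P^{(k)}_{ij}$; compute $\boldsymbol R^{(k)}=\hat{\boldsymbol Q}-\hat{\boldsymbol A}\boldsymbol P^{(k)}\hat{\boldsymbol B}^T$; draw $t_k\in[t]$ and $s_k\in[s]$, independently of each other and of all previous draws, with $$\mathbb P(t_k=i)=\frac{\|\hat{\boldsymbol A}_{:,U_i}\|_F^2}{\|\hat{\boldsymbol A}\|_F^2},\qquad \mathbb P(s_k=j)=\frac{\|\hat{\boldsymbol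 B}_{:,V_j}\|_F^2}{\|\hat{\boldsymbol B}\|_F^2};$$ then update $$\boldsymbol P^{(k+1)}_{U_{t_k},V_{s_k}}=\boldsymbol P^{(k)}_{U_{t_k},V_{s_k}}+\frac{1}{\|\hat{\boldsymbol A}_{:,U_{t_k}}\|_F^2\,\|\hat{\boldsymbol B}_{:,V_{s_k}}\|_F^2}\,\hat{\boldsymbol A}_{:,U_{t_k}}^T\boldsymbol R^{(k)}\hat{\boldsymbol B}_{:,V_{s_k}},$$ keeping all other control points unchanged (the same $t_k,s_k$ are used for all three coordinates). The iteration is run indefinitely. *)

theory Defs
  imports
    "HOL-Probability.Probability"
    "Jordan_Normal_Form.Gauss_Jordan_Elimination"
    "Jordan_Normal_Form.DL_Rank"
    "Jordan_Normal_Form.DL_Submatrix"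
begin

unbundle no vec_syntax
hide_const (open) Finite_Cartesian_Product.mat Finite_Cartesian_Product.row

definition frob_norm :: "real mat \<Rightarrow> real" where
  "frob_norm A = sqrt (\<Sum>i<dim_row A. \<Sum>j<dim_col A. (A $$ (i, j))\<^sup>2)"

definition full_column_rank :: "real mat \<Rightarrow> bool" where
  "full_column_rank A \<longleftrightarrow> vec_space.rank (dim_row A) A = dim_col A"

definition cols_sub :: "real mat \<Rightarrow> nat set \<Rightarrow> real mat" where
  "cols_sub A U = submatrix A UNIV U"

text \<open>The value is meaningful for invertible matrices only.\<close>

definition inv_mat :: "real mat \<Rightarrow> real mat" where
  "inv_mat A = the (mat_inverse A)"

text \<open>A family of points of three-dimensional space is a matrix with entries in \<^typ>\<open>real ^ 3\<close>;
  \<open>coord f\<close> extracts the real matrix of the coordinates with index \<open>f\<close>.\<close>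

definition coord :: "3 \<Rightarrow> (real ^ 3) mat \<Rightarrow> real mat" where
  "coord f P = map_mat (\<lambda>v. vec_nth v f) P"

definition of_coords :: "nat \<Rightarrow> nat \<Rightarrow> (3 \<Rightarrow> real mat) \<Rightarrow> (real ^ 3) mat" where
  "of_coords r c X = mat r c (\<lambda>(i, j). vec_lambda (\<lambda>f. X f $$ (i, j)))"

text \<open>Partitions of \<open>{0,\<dots>,n}\<close> into the \<open>t + 1\<close> blocks \<open>U 0, \<dots>, U t\<close>.\<close>

definition indexed_partition :: "(nat \<Rightarrow> nat set) \<Rightarrow> nat \<Rightarrow> nat \<Rightarrow> bool" where
  "indexed_partition U t n \<longleftrightarrow>
     (\<forall>i\<le>t. U i \<noteq> {}) \<and> disjoint_family_on U {..t} \<and> (\<Union>i\<le>t. U i) = {..n}"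

definition collocation_mat :: "(nat \<Rightarrow> real \<Rightarrow> real) \<Rightarrow> nat \<Rightarrow> (nat \<Rightarrow> real) \<Rightarrow> nat \<Rightarrow> real mat" where
  "collocation_mat \<mu> n x m = mat (m + 1) (n + 1) (\<lambda>(h, i). \<mu> i (x h))"

text \<open>Rows \<open>0\<close> and \<open>n\<close> (the boundary conditions) are unconstrained.\<close>

definition second_difference_mat :: "nat \<Rightarrow> real mat \<Rightarrow> bool" where
  "second_difference_mat n L \<longleftrightarrow> L \<in> carrier_mat (n + 1) (n + 1) \<and>
     (\<exists>C>0. \<forall>i. 0 < i \<and> i < n \<longrightarrow> (\<forall>p\<in>carrier_vec (n + 1).
        (L *\<^sub>v p) $ i = C * (p $ (i - 1) - 2 * p $ i + p $ (i + 1))))"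

definition augmented_mat :: "real mat \<Rightarrow> real \<Rightarrow> real mat \<Rightarrow> real mat" where
  "augmented_mat A reg L = A @\<^sub>r (sqrt reg \<cdot>\<^sub>m L)"

definition augmented_data :: "(real ^ 3) mat \<Rightarrow> nat \<Rightarrow> nat \<Rightarrow> (real ^ 3) mat" where
  "augmented_data Q r c =
     four_block_mat Q (0\<^sub>m (dim_row Q) c) (0\<^sub>m r (dim_col Q)) (0\<^sub>m r c)"

definition surface ::
  "(nat \<Rightarrow> real \<Rightarrow> real) \<Rightarrow> (nat \<Rightarrow> real \<Rightarrow> real) \<Rightarrow> nat \<Rightarrow> nat \<Rightarrow> (real ^ 3) mat \<Rightarrow> real \<Rightarrow> real \<Rightarrow> real ^ 3"
  where
  "surface \<mu> v n1 n2 P x y = (\<Sum>i\<le>n1. \<Sum>j\<le>n2. (\<mu> i x * v j y) *\<^sub>R (P $$ (i, j)))"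

text \<open>In the following, \<open>A\<close>, \<open>B\<close> and \<open>Q\<close> stand for the augmented matrices and data.\<close>

definition residual :: "real mat \<Rightarrow> real mat \<Rightarrow> real mat \<Rightarrow> real mat \<Rightarrow> real mat" where
  "residual A B Q P = Q - A * P * B\<^sup>T"

definition block_increment ::
  "real mat \<Rightarrow> real mat \<Rightarrow> real mat \<Rightarrow> nat set \<Rightarrow> nat set \<Rightarrow> real mat" where
  "block_increment A B R U V =
     (1 / ((frob_norm (cols_sub A U))\<^sup>2 * (frob_norm (cols_sub B V))\<^sup>2)) \<cdot>\<^sub>m
       ((cols_sub A U)\<^sup>T * R * cols_sub B V)"

text \<open>An index \<open>i \<in> U\<close> sits at position \<open>card {a \<in> U. a < i}\<close> of a block indexed by \<open>U\<close>.\<close>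

definition block_update ::
  "real mat \<Rightarrow> real mat \<Rightarrow> real mat \<Rightarrow> nat set \<Rightarrow> nat set \<Rightarrow> real mat \<Rightarrow> real mat" where
  "block_update A B Q U V P = mat (dim_row P) (dim_col P) (\<lambda>(i, j).
     if i \<in> U \<and> j \<in> V
     then P $$ (i, j) + block_increment A B (residual A B Q P) U V
            $$ (card {a \<in> U. a < i}, card {b \<in> V. b < j})
     else P $$ (i, j))"

text \<open>The control points after \<open>k\<close> steps, when step \<open>k\<close> uses the blocks \<open>U (\<tau> k)\<close> and \<open>V (\<sigma> k)\<close>.\<close>

primrec rpia ::
  "real mat \<Rightarrow> real mat \<Rightarrow> (real ^ 3) mat \<Rightarrow> (nat \<Rightarrow> nat set) \<Rightarrow> (nat \<Rightarrow> nat set) \<Rightarrow> (real ^ 3) mat \<Rightarrow>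
   (nat \<Rightarrow> nat) \<Rightarrow> (nat \<Rightarrow> nat) \<Rightarrow> nat \<Rightarrow> (real ^ 3) mat" where
  "rpia A B Q U V P0 \<tau> \<sigma> 0 = P0"
| "rpia A B Q U V P0 \<tau> \<sigma> (Suc k) =
     (let P = rpia A B Q U V P0 \<tau> \<sigma> k
      in of_coords (dim_row P) (dim_col P)
           (\<lambda>f. block_update A B (coord f Q) (U (\<tau> k)) (V (\<sigma> k)) (coord f P)))"

text \<open>Joint independence of all the draws \<open>T 0, S 0, T 1, S 1, \<dots>\<close> (indexed by \<^typ>\<open>nat + nat\<close>)
  together with their distributions.  Independence includes that \<open>T k\<close> and \<open>S k\<close> are random
  variables with values in \<open>{0,\<dots>,t}\<close> and \<open>{0,\<dots>,s}\<close>.\<close>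

definition rpia_draws ::
  "'w measure \<Rightarrow> real mat \<Rightarrow> real mat \<Rightarrow> nat \<Rightarrow> (nat \<Rightarrow> nat set) \<Rightarrow> nat \<Rightarrow> (nat \<Rightarrow> nat set) \<Rightarrow>
   (nat \<Rightarrow> 'w \<Rightarrow> nat) \<Rightarrow> (nat \<Rightarrow> 'w \<Rightarrow> nat) \<Rightarrow> bool" where
  "rpia_draws M A B t U s V T S \<longleftrightarrow>
     prob_space.indep_vars M
       (case_sum (\<lambda>_. count_space {..t}) (\<lambda>_. count_space {..s})) (case_sum T S) UNIV \<and>
     (\<forall>k. \<forall>i\<le>t. measure M {\<omega> \<in> space M. T k \<omega> = i}
        = (frob_norm (cols_sub A (U i)))\<^sup>2 / (frob_norm A)\<^sup>2) \<and>
     (\<forall>k. \<forall>j\<le>s. measure M {\<omega> \<in> space M. S k \<omega> = j}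
        = (frob_norm (cols_sub B (V j)))\<^sup>2 / (frob_norm B)\<^sup>2)"

definition lsq_solution :: "real mat \<Rightarrow> real mat \<Rightarrow> real mat \<Rightarrow> real mat" where
  "lsq_solution A B Q = inv_mat (A\<^sup>T * A) * A\<^sup>T * Q * B * inv_mat (B\<^sup>T * B)"

end

theory Submission
  imports Defs
begin

text \<open>
  Write \<open>A\<close>, \<open>B\<close> for the augmented matrices, fix one coordinate, and let \<open>S\<close> be the least-squares
  solution. A random step changes only one block of the control points \<open>X\<close>, by the corresponding
  block of \<open>A\<^sup>T R B\<close> divided by the block weight, where \<open>R = Q - A X B\<^sup>T\<close>. The block is drawn with
  probability proportional to that same weight and independently of \<open>X\<close>. Hence the weights cancel
  and the means \<open>E\<^sub>k\<close> of the control points obey a deterministic gradient iteration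
  \<open>E\<^sub>k\<^sub>+\<^sub>1 = E\<^sub>k + c A\<^sup>T (Q - A E\<^sub>k B\<^sup>T) B\<close> with \<open>c = 1 / (\<parallel>A\<parallel>\<^sup>2 \<parallel>B\<parallel>\<^sup>2)\<close> in Frobenius norms
  (\<open>ctrl_step\<close>, which rests on \<open>grad_indep_draw\<close> and \<open>block_weight_cancel\<close>).

  By the normal equation the errors \<open>D\<^sub>k = E\<^sub>k - S\<close> satisfy \<open>D\<^sub>k\<^sub>+\<^sub>1 = D\<^sub>k - c A\<^sup>T (A D\<^sub>k B\<^sup>T) B\<close>. This
  map is a contraction: submultiplicativity of the Frobenius norm gives
  \<open>\<parallel>D\<^sub>k\<^sub>+\<^sub>1\<parallel>\<^sup>2 \<le> \<parallel>D\<^sub>k\<parallel>\<^sup>2 - c \<parallel>A D\<^sub>k B\<^sup>T\<parallel>\<^sup>2\<close>, and since \<open>A\<close> and \<open>B\<close> have left inverses, \<open>\<parallel>D\<^sub>k\<parallel>\<^sup>2\<close> is at most a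
  constant times \<open>\<parallel>A D\<^sub>k B\<^sup>T\<parallel>\<^sup>2\<close> (\<open>normal_operator_contraction\<close>). So \<open>E\<^sub>k\<close> converges to \<open>S\<close>.

  That \<open>S\<close> is the unique minimizer is Pythagoras in the Frobenius inner product
  (\<open>lsq_solution_is_arg_min_iff\<close>). A point of a surface is a finite linear combination of
  control points, so the convergence passes from control points to surfaces.
\<close>

section \<open>The Frobenius norm and inner product\<close>

lemma frob_norm_sq: "(frob_norm A)\<^sup>2 = (\<Sum>i<dim_row A. \<Sum>j<dim_col A. (A $$ (i, j))\<^sup>2)"
  unfolding frob_norm_def by (simp add: sum_nonneg)

lemma entry_sq_le_frob_norm_sq:
  assumes "i < dim_row A" "j < dim_col A"
  shows "(A $$ (i, j))\<^sup>2 \<le> (frob_norm A)\<^sup>2"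
proof -
  have "(A $$ (i, j))\<^sup>2 \<le> (\<Sum>j<dim_col A. (A $$ (i, j))\<^sup>2)"
    using assms by (intro member_le_sum) auto
  also have "\<dots> \<le> (\<Sum>i<dim_row A. \<Sum>j<dim_col A. (A $$ (i, j))\<^sup>2)"
    using assms by (intro member_le_sum[where f = "\<lambda>i. \<Sum>j<dim_col A. (A $$ (i, j))\<^sup>2"])
      (auto intro: sum_nonneg)
  finally show ?thesis by (simp add: frob_norm_sq)
qed

lemma frob_norm_sq_eq_0_imp_zero:
  assumes "A \<in> carrier_mat m n" "(frob_norm A)\<^sup>2 = 0"
  shows "A = 0\<^sub>m m n"
proof (rule eq_matI)
  fix i j assume "i < dim_row (0\<^sub>m m n :: real mat)" "j < dim_col (0\<^sub>m m n :: real mat)"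
  then show "A $$ (i, j) = 0\<^sub>m m n $$ (i, j)"
    using entry_sq_le_frob_norm_sq[of i A j] assms by auto
qed (use assms in auto)

lemma frob_norm_transpose: "frob_norm A\<^sup>T = frob_norm A"
proof -
  have "(\<Sum>i<dim_col A. \<Sum>j<dim_row A. (A\<^sup>T $$ (i, j))\<^sup>2)
      = (\<Sum>i<dim_col A. \<Sum>j<dim_row A. (A $$ (j, i))\<^sup>2)"
    by (intro sum.cong refl) auto
  then show ?thesis
    by (subst (asm) sum.swap) (simp add: frob_norm_def)
qed

lemma index_mult_mat_sum:
  assumes "A \<in> carrier_mat m n" "B \<in> carrier_mat n q" "i < m" "j < q"
  shows "(A * B) $$ (i, j) = (\<Sum>k<n. A $$ (i, k) * B $$ (k, j))"
  using assms by (auto simp: scalar_prod_def atLeast0LessThan intro!: sum.cong)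

lemma index_mult_mat_sum3:
  assumes "A \<in> carrier_mat m n" "X \<in> carrier_mat n q" "B \<in> carrier_mat q r" "i < m" "j < r"
  shows "(A * X * B) $$ (i, j) = (\<Sum>k<n. \<Sum>l<q. A $$ (i, k) * X $$ (k, l) * B $$ (l, j))"
proof -
  have "(A * X * B) $$ (i, j) = (\<Sum>l<q. (\<Sum>k<n. A $$ (i, k) * X $$ (k, l)) * B $$ (l, j))"
    using assms by (subst index_mult_mat_sum[of _ m q _ r])
      (auto simp: index_mult_mat_sum[of A m n X q] simp del: index_mult_mat(1))
  then show ?thesis
    by (simp add: sum_distrib_right sum.swap[of _ "{..<q}"])
qed

lemma frob_norm_mult_sq_le:
  assumes "A \<in> carrier_mat m n" "B \<in> carrier_mat n q"
  shows "(frob_norm (A * B))\<^sup>2 \<le> (frob_norm A)\<^sup>2 * (frob_norm B)\<^sup>2"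
proof -
  have "(frob_norm (A * B))\<^sup>2 = (\<Sum>i<m. \<Sum>j<q. (\<Sum>k<n. A $$ (i, k) * B $$ (k, j))\<^sup>2)"
    unfolding frob_norm_sq using assms
    by (intro sum.cong) (auto simp: index_mult_mat_sum[OF assms] simp del: index_mult_mat(1))
  also have "\<dots> \<le> (\<Sum>i<m. \<Sum>j<q. (\<Sum>k<n. (A $$ (i, k))\<^sup>2) * (\<Sum>k<n. (B $$ (k, j))\<^sup>2))"
    by (intro sum_mono Cauchy_Schwarz_ineq_sum)
  also have "\<dots> = (\<Sum>i<m. \<Sum>k<n. (A $$ (i, k))\<^sup>2) * (\<Sum>j<q. \<Sum>k<n. (B $$ (k, j))\<^sup>2)"
    by (simp add: sum_product)
  also have "(\<Sum>j<q. \<Sum>k<n. (B $$ (k, j))\<^sup>2) = (frob_norm B)\<^sup>2"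
    unfolding frob_norm_sq using assms by (subst sum.swap) auto
  finally show ?thesis using assms by (simp add: frob_norm_sq)
qed

lemma frob_norm_mult3_sq_le:
  assumes "A \<in> carrier_mat m n" "X \<in> carrier_mat n q" "B \<in> carrier_mat q r"
  shows "(frob_norm (A * X * B))\<^sup>2 \<le> (frob_norm A)\<^sup>2 * (frob_norm X)\<^sup>2 * (frob_norm B)\<^sup>2"
proof -
  have "(frob_norm (A * X * B))\<^sup>2 \<le> (frob_norm (A * X))\<^sup>2 * (frob_norm B)\<^sup>2"
    using assms by (intro frob_norm_mult_sq_le) auto
  also have "\<dots> \<le> (frob_norm A)\<^sup>2 * (frob_norm X)\<^sup>2 * (frob_norm B)\<^sup>2"
    using assms by (intro mult_right_mono frob_norm_mult_sq_le) auto
  finally show ?thesis .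
qed

definition frob_inner :: "real mat \<Rightarrow> real mat \<Rightarrow> real" where
  "frob_inner A B = (\<Sum>i<dim_row A. \<Sum>j<dim_col A. A $$ (i, j) * B $$ (i, j))"

lemma frob_inner_self: "frob_inner A A = (frob_norm A)\<^sup>2"
  unfolding frob_norm_sq frob_inner_def by (simp add: power2_eq_square)

text \<open>The map \<open>X \<mapsto> A X B\<^sup>T\<close> has the adjoint \<open>Y \<mapsto> A\<^sup>T Y B\<close>; this is what makes
  \<open>A\<^sup>T R B\<close> the descent direction of the least-squares functional.\<close>

lemma frob_inner_two_sided_adjoint:
  assumes "A \<in> carrier_mat m n" "X \<in> carrier_mat n q" "B \<in> carrier_mat r q" "Y \<in> carrier_mat m r"
  shows "frob_inner (A * X * B\<^sup>T) Y = frob_inner X (A\<^sup>T * Y * B)"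
proof -
  define g where "g i j k l = A $$ (i, k) * X $$ (k, l) * B $$ (j, l) * Y $$ (i, j)" for i j k l
  have l: "(A * X * B\<^sup>T) $$ (i, j) * Y $$ (i, j) = (\<Sum>k<n. \<Sum>l<q. g i j k l)"
    if "i < m" "j < r" for i j
  proof -
    have "(A * X * B\<^sup>T) $$ (i, j) = (\<Sum>k<n. \<Sum>l<q. A $$ (i, k) * X $$ (k, l) * B\<^sup>T $$ (l, j))"
      using assms that by (intro index_mult_mat_sum3) auto
    then show ?thesis
      using assms that by (auto simp: sum_distrib_right g_def intro!: sum.cong)
  qed
  have r: "X $$ (k, l) * (A\<^sup>T * Y * B) $$ (k, l) = (\<Sum>i<m. \<Sum>j<r. g i j k l)"
    if "k < n" "l < q" for k l
  proof -
    have "(A\<^sup>T * Y * B) $$ (k, l) = (\<Sum>i<m. \<Sum>j<r. A\<^sup>T $$ (k, i) * Y $$ (i, j) * B $$ (j, l))"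
      using assms that by (intro index_mult_mat_sum3) auto
    then show ?thesis
      using assms that by (auto simp: sum_distrib_left g_def intro!: sum.cong)
  qed
  have "frob_inner (A * X * B\<^sup>T) Y = (\<Sum>i<m. \<Sum>j<r. \<Sum>k<n. \<Sum>l<q. g i j k l)"
    unfolding frob_inner_def using assms l by (intro sum.cong) auto
  also have "\<dots> = (\<Sum>i<m. \<Sum>k<n. \<Sum>j<r. \<Sum>l<q. g i j k l)"
    by (intro sum.cong refl sum.swap)
  also have "\<dots> = (\<Sum>k<n. \<Sum>i<m. \<Sum>l<q. \<Sum>j<r. g i j k l)"
    by (subst sum.swap) (intro sum.cong refl sum.swap)
  also have "\<dots> = (\<Sum>k<n. \<Sum>l<q. \<Sum>i<m. \<Sum>j<r. g i j k l)"
    by (intro sum.cong refl sum.swap)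
  also have "\<dots> = frob_inner X (A\<^sup>T * Y * B)"
    unfolding frob_inner_def using assms r by (intro sum.cong) auto
  finally show ?thesis .
qed

lemma frob_norm_add_smult_sq:
  assumes "X \<in> carrier_mat m n" "Y \<in> carrier_mat m n"
  shows "(frob_norm (X + c \<cdot>\<^sub>m Y))\<^sup>2
    = (frob_norm X)\<^sup>2 + 2 * c * frob_inner X Y + c\<^sup>2 * (frob_norm Y)\<^sup>2"
proof -
  have "(frob_norm (X + c \<cdot>\<^sub>m Y))\<^sup>2 = (\<Sum>i<m. \<Sum>j<n. (X $$ (i, j) + c * Y $$ (i, j))\<^sup>2)"
    unfolding frob_norm_sq using assms by (intro sum.cong) auto
  also have "\<dots> = (\<Sum>i<m. \<Sum>j<n. (X $$ (i, j))\<^sup>2 + 2 * c * (X $$ (i, j) * Y $$ (i, j))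
      + c\<^sup>2 * (Y $$ (i, j))\<^sup>2)"
    by (simp add: power2_sum power_mult_distrib algebra_simps)
  also have "\<dots> = (frob_norm X)\<^sup>2 + 2 * c * frob_inner X Y + c\<^sup>2 * (frob_norm Y)\<^sup>2"
    unfolding frob_norm_sq frob_inner_def using assms
    by (simp add: sum.distrib sum_distrib_left)
  finally show ?thesis .
qed

section \<open>Full column rank and the Gram matrix\<close>

text \<open>The rank only sees the set of columns, so dropping repeated columns preserves it, while the
  remaining matrix is too narrow to have rank \<^term>\<open>dim_col A\<close>.\<close>

lemma full_column_rank_distinct_cols:
  assumes "full_column_rank A"
  shows "distinct (cols A)"
proof (rule ccontr)
  assume nd: "\<not> distinct (cols A)"
  define n where "n = dim_row A"
  interpret vec_space "TYPE(real)" n .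
  define B where "B = mat_of_cols n (remdups (cols A))"
  have sub: "set (cols A) \<subseteq> carrier_vec n"
    using cols_dim[of A] by (simp add: n_def)
  have "set (cols B) = set (cols A)"
    using sub by (simp add: B_def)
  then have "rank A = rank B" by (simp add: rank_def)
  also have "\<dots> \<le> length (remdups (cols A))"
    by (rule rank_le_nc) (simp add: B_def)
  also have "\<dots> < dim_col A"
    using nd by (metis cols_length length_remdups_leq length_remdups_eq le_neq_implies_less remdups_id_iff_distinct)
  finally show False
    using assms by (simp add: full_column_rank_def n_def)
qed

lemma full_column_rank_kernel:
  assumes "full_column_rank A" "z \<in> carrier_vec (dim_col A)" "A *\<^sub>v z = 0\<^sub>v (dim_row A)"
  shows "z = 0\<^sub>v (dim_col A)"
proof (rule ccontr)
  assume z: "z \<noteq> 0\<^sub>v (dim_col A)"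
  interpret vec_space "TYPE(real)" "dim_row A" .
  have A: "A \<in> carrier_mat (dim_row A) (dim_col A)" by auto
  note d = full_column_rank_distinct_cols[OF assms(1)]
  have "lin_indpt (set (cols A))"
    using full_rank_lin_indpt[OF A _ d] assms(1) by (simp add: full_column_rank_def)
  then show False
    using lin_depI[OF A assms(2) z assms(3) d] by simp
qed

text \<open>The Gram matrix is injective because \<open>A\<^sup>T A z = 0\<close> forces
  \<open>\<parallel>A z\<parallel>\<^sup>2 = z \<bullet> A\<^sup>T A z = 0\<close>.\<close>

lemma inv_mat_gram:
  assumes A: "A \<in> carrier_mat m n" and "full_column_rank A"
  shows "inv_mat (A\<^sup>T * A) \<in> carrier_mat n n" (is ?c)
    and "inv_mat (A\<^sup>T * A) * (A\<^sup>T * A) = 1\<^sub>m n" (is ?l)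
    and "(A\<^sup>T * A) * inv_mat (A\<^sup>T * A) = 1\<^sub>m n" (is ?r)
proof -
  define G where "G = A\<^sup>T * A"
  have G: "G \<in> carrier_mat n n" using A by (auto simp: G_def)
  have "z = 0\<^sub>v n" if z: "z \<in> carrier_vec n" and Gz: "G *\<^sub>v z = 0\<^sub>v n" for z
  proof -
    have Az: "A *\<^sub>v z \<in> carrier_vec m" using A z by auto
    have "(A *\<^sub>v z) \<bullet> (A *\<^sub>v z) = (A\<^sup>T *\<^sub>v (A *\<^sub>v z)) \<bullet> z"
      using transpose_vec_mult_scalar[OF A z Az] by simp
    also have "A\<^sup>T *\<^sub>v (A *\<^sub>v z) = 0\<^sub>v n"
      using Gz A z by (simp add: G_def assoc_mult_mat_vec[of _ n m _ n])
    finally have "(\<Sum>i<m. ((A *\<^sub>v z) $ i)\<^sup>2) = 0"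
      using z Az A by (simp add: scalar_prod_def[of "A *\<^sub>v z"] power2_eq_square atLeast0LessThan
          del: index_mult_mat_vec)
    then have "A *\<^sub>v z = 0\<^sub>v m"
      using Az A by (intro eq_vecI) (auto simp: sum_nonneg_eq_0_iff)
    then show ?thesis using full_column_rank_kernel[OF assms(2), of z] A z by auto
  qed
  then have "det G \<noteq> 0" using det_0_iff_vec_prod_zero_field[OF G] by auto
  then have "mat_inverse G \<noteq> None"
    using mat_inverse(1)[OF G, of "()"] det_non_zero_imp_unit[OF G, of "()"] by auto
  then have "mat_inverse G = Some (inv_mat G)"
    by (auto simp: inv_mat_def)
  from mat_inverse(2)[OF G this] show ?c ?l ?r by (auto simp: G_def)
qed

section \<open>The least-squares solution and the contraction towards it\<close>

text \<open>A form of associativity whose premises the simplifier can decide by computing dimensions; it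
  brings products of many factors to right-nested form.\<close>

lemma mult_mat_assoc_dim:
  "dim_col A = dim_row B \<Longrightarrow> dim_col B = dim_row C \<Longrightarrow> A * B * C = A * (B * C)"
  by (rule assoc_mult_mat[of A "dim_row A" "dim_col A" B "dim_col B" C "dim_col C"]) auto

lemma gram_sandwich:
  assumes "A \<in> carrier_mat m n" "X \<in> carrier_mat n q" "B \<in> carrier_mat r q"
  shows "A\<^sup>T * (A * X * B\<^sup>T) * B = A\<^sup>T * A * X * (B\<^sup>T * B)"
  using assms by (simp add: mult_mat_assoc_dim)

lemma lsq_solution_carrier:
  assumes "A \<in> carrier_mat m n" "B \<in> carrier_mat r q" "Q \<in> carrier_mat m r"
    and "full_column_rank A" "full_column_rank B"
  shows "lsq_solution A B Q \<in> carrier_mat n q"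
  using assms inv_mat_gram(1)[of A m n] inv_mat_gram(1)[of B r q]
  by (auto simp: lsq_solution_def)

lemma lsq_solution_normal_equation:
  assumes A: "A \<in> carrier_mat m n" and B: "B \<in> carrier_mat r q" and Q: "Q \<in> carrier_mat m r"
    and "full_column_rank A" "full_column_rank B"
  shows "A\<^sup>T * A * lsq_solution A B Q * (B\<^sup>T * B) = A\<^sup>T * Q * B"
proof -
  define G H where "G = A\<^sup>T * A" and "H = B\<^sup>T * B"
  define G' H' where "G' = inv_mat G" and "H' = inv_mat H"
  note G' = inv_mat_gram[OF A assms(4), folded G_def, folded G'_def]
  note H' = inv_mat_gram[OF B assms(5), folded H_def, folded H'_def]
  have c: "G \<in> carrier_mat n n" "H \<in> carrier_mat q q"
    using A B by (auto simp: G_def H_def)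
  have "G * lsq_solution A B Q * H = (G * G') * (A\<^sup>T * Q * B) * (H' * H)"
    using A B Q G'(1) H'(1) c
    by (simp add: lsq_solution_def mult_mat_assoc_dim flip: G_def H_def G'_def H'_def)
  also have "\<dots> = A\<^sup>T * Q * B"
    using A B Q by (simp add: G'(3) H'(2))
  finally show ?thesis by (simp add: G_def H_def)
qed

lemma residual_sandwich:
  assumes A: "A \<in> carrier_mat m n" and B: "B \<in> carrier_mat r q" and Q: "Q \<in> carrier_mat m r"
    and X: "X \<in> carrier_mat n q"
  shows "A\<^sup>T * residual A B Q X * B = A\<^sup>T * Q * B - A\<^sup>T * A * X * (B\<^sup>T * B)"
proof -
  have "A\<^sup>T * residual A B Q X * B = A\<^sup>T * Q * B - A\<^sup>T * (A * X * B\<^sup>T) * B"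
    unfolding residual_def using A B Q X
    by (simp add: mult_minus_distrib_mat[of _ n m _ r] minus_mult_distrib_mat[of _ n r _ _ q])
  then show ?thesis by (simp add: gram_sandwich[OF A X B])
qed

text \<open>Since the least-squares solution solves the normal equation, the descent direction depends on
  the data only through the error of \<open>X\<close>.\<close>

lemma transposed_residual:
  assumes A: "A \<in> carrier_mat m n" and B: "B \<in> carrier_mat r q" and Q: "Q \<in> carrier_mat m r"
    and "full_column_rank A" "full_column_rank B" and X: "X \<in> carrier_mat n q"
  shows "A\<^sup>T * residual A B Q X * B
    = - 1 \<cdot>\<^sub>m (A\<^sup>T * (A * (X - lsq_solution A B Q) * B\<^sup>T) * B)"
proof -
  define G H S where "G = A\<^sup>T * A" and "H = B\<^sup>T * B" and "S = lsq_solution A B Q"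
  have S: "S \<in> carrier_mat n q"
    unfolding S_def by (rule lsq_solution_carrier) fact+
  have c: "G \<in> carrier_mat n n" "H \<in> carrier_mat q q"
    using A B by (auto simp: G_def H_def)
  have "A\<^sup>T * residual A B Q X * B = G * S * H - G * X * H"
    using residual_sandwich[OF A B Q X] lsq_solution_normal_equation[OF assms(1-5)]
    by (simp add: G_def H_def S_def)
  also have "\<dots> = - 1 \<cdot>\<^sub>m (G * X * H - G * S * H)"
    using c X S by (intro eq_matI) auto
  also have "G * X * H - G * S * H = G * (X - S) * H"
    using c X S by (simp add: mult_minus_distrib_mat[of _ n n _ q] minus_mult_distrib_mat[of _ n q _ _ q])
  also have "\<dots> = A\<^sup>T * (A * (X - S) * B\<^sup>T) * B"
    using gram_sandwich[OF A minus_carrier_mat[OF S] B] by (simp add: G_def H_def)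
  finally show ?thesis by (simp add: S_def)
qed

lemma full_column_rank_left_inverse:
  assumes A: "A \<in> carrier_mat m n" and "full_column_rank A"
  obtains L where "L \<in> carrier_mat n m" "L * A = 1\<^sub>m n"
proof
  show "inv_mat (A\<^sup>T * A) * A\<^sup>T \<in> carrier_mat n m"
    using A inv_mat_gram(1)[OF assms] by auto
  show "inv_mat (A\<^sup>T * A) * A\<^sup>T * A = 1\<^sub>m n"
    using A inv_mat_gram(1,2)[OF assms] by (simp add: mult_mat_assoc_dim)
qed

lemma frob_norm_pos_of_left_inverse:
  assumes "L \<in> carrier_mat n m" "A \<in> carrier_mat m n" "L * A = 1\<^sub>m n" "0 < n"
  shows "0 < (frob_norm L)\<^sup>2" "0 < (frob_norm A)\<^sup>2"
proof -
  have "0 < ((1\<^sub>m n :: real mat) $$ (0, 0))\<^sup>2" using assms(4) by simp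
  also have "\<dots> \<le> (frob_norm (1\<^sub>m n))\<^sup>2"
    using assms(4) by (intro entry_sq_le_frob_norm_sq) auto
  also have "\<dots> \<le> (frob_norm L)\<^sup>2 * (frob_norm A)\<^sup>2"
    using frob_norm_mult_sq_le[OF assms(1,2)] assms(3) by simp
  finally show "0 < (frob_norm L)\<^sup>2" "0 < (frob_norm A)\<^sup>2"
    by (auto simp: zero_less_mult_iff)
qed

text \<open>With left inverses \<open>L\<close> and \<open>N\<close>, the matrix \<open>D\<close> is recovered as \<open>L (A D B\<^sup>T) N\<^sup>T\<close>, and the
  Frobenius norm is submultiplicative. This bounds
  \<open>D \<mapsto> A D B\<^sup>T\<close> from below, quantifying its injectivity.\<close>

lemma two_sided_lower_bound:
  assumes A: "A \<in> carrier_mat m n" and B: "B \<in> carrier_mat r q"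
    and "full_column_rank A" "full_column_rank B" "0 < n" "0 < q"
  shows "\<exists>K>0. \<forall>D\<in>carrier_mat n q. (frob_norm D)\<^sup>2 \<le> K * (frob_norm (A * D * B\<^sup>T))\<^sup>2"
proof -
  obtain L where L: "L \<in> carrier_mat n m" "L * A = 1\<^sub>m n"
    using full_column_rank_left_inverse[OF A assms(3)] .
  obtain N where N: "N \<in> carrier_mat q r" "N * B = 1\<^sub>m q"
    using full_column_rank_left_inverse[OF B assms(4)] .
  show ?thesis
  proof (intro exI conjI ballI)
    show "0 < (frob_norm L)\<^sup>2 * (frob_norm N)\<^sup>2"
      using frob_norm_pos_of_left_inverse(1)[OF L(1) A L(2)]
        frob_norm_pos_of_left_inverse(1)[OF N(1) B N(2)] assms by simp
    fix D :: "real mat" assume D: "D \<in> carrier_mat n q"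
    have t: "B\<^sup>T * N\<^sup>T = 1\<^sub>m q"
      using transpose_mult[OF N(1) B] N(2) by simp
    have "L * (A * D * B\<^sup>T) * N\<^sup>T = (L * A) * D * (B\<^sup>T * N\<^sup>T)"
      using L(1) N(1) A B D by (simp add: mult_mat_assoc_dim)
    also have "\<dots> = D" using D by (simp add: L(2) t)
    finally have "(frob_norm D)\<^sup>2 = (frob_norm (L * (A * D * B\<^sup>T) * N\<^sup>T))\<^sup>2" by simp
    also have "\<dots> \<le> (frob_norm L)\<^sup>2 * (frob_norm (A * D * B\<^sup>T))\<^sup>2 * (frob_norm N\<^sup>T)\<^sup>2"
      using L(1) N(1) A B D by (intro frob_norm_mult3_sq_le) auto
    finally show "(frob_norm D)\<^sup>2
        \<le> (frob_norm L)\<^sup>2 * (frob_norm N)\<^sup>2 * (frob_norm (A * D * B\<^sup>T))\<^sup>2"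
      by (simp add: frob_norm_transpose mult_ac)
  qed
qed

text \<open>With \<open>Z = A D B\<^sup>T\<close> and \<open>c = 1 / (\<parallel>A\<parallel>\<^sup>2 \<parallel>B\<parallel>\<^sup>2)\<close>, expanding the square gives
  \<open>\<parallel>D\<parallel>\<^sup>2 - 2 c \<parallel>Z\<parallel>\<^sup>2 + c\<^sup>2 \<parallel>A\<^sup>T Z B\<parallel>\<^sup>2\<close>. By submultiplicativity the last term is at most \<open>c \<parallel>Z\<parallel>\<^sup>2\<close>, which is
  half of what the middle term removes, and \<open>\<parallel>Z\<parallel>\<^sup>2\<close> controls \<open>\<parallel>D\<parallel>\<^sup>2\<close> from above.\<close>

lemma normal_operator_contraction:
  assumes A: "A \<in> carrier_mat m n" and B: "B \<in> carrier_mat r q"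
    and "full_column_rank A" "full_column_rank B" "0 < n" "0 < q"
  defines "c \<equiv> 1 / ((frob_norm A)\<^sup>2 * (frob_norm B)\<^sup>2)"
  shows "\<exists>\<rho>\<ge>0. \<rho> < 1 \<and> (\<forall>D\<in>carrier_mat n q.
      (frob_norm (D + - c \<cdot>\<^sub>m (A\<^sup>T * (A * D * B\<^sup>T) * B)))\<^sup>2 \<le> \<rho> * (frob_norm D)\<^sup>2)"
proof -
  obtain K where K: "0 < K"
    "\<And>D :: real mat. D \<in> carrier_mat n q \<Longrightarrow> (frob_norm D)\<^sup>2 \<le> K * (frob_norm (A * D * B\<^sup>T))\<^sup>2"
    using two_sided_lower_bound[OF assms(1-6)] by blast
  obtain L where L: "L \<in> carrier_mat n m" "L * A = 1\<^sub>m n"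
    using full_column_rank_left_inverse[OF A assms(3)] .
  obtain N where N: "N \<in> carrier_mat q r" "N * B = 1\<^sub>m q"
    using full_column_rank_left_inverse[OF B assms(4)] .
  have pos: "0 < (frob_norm A)\<^sup>2" "0 < (frob_norm B)\<^sup>2"
    using frob_norm_pos_of_left_inverse(2)[OF L(1) A L(2)]
      frob_norm_pos_of_left_inverse(2)[OF N(1) B N(2)] assms by simp_all
  then have c: "0 < c" by (simp add: c_def)
  show ?thesis
  proof (intro exI conjI ballI)
    \<comment> \<open>The maximum makes nonnegativity immediate; the bound below stays valid when the rate grows.\<close>
    show "0 \<le> max 0 (1 - c / K)" "max 0 (1 - c / K) < 1"
      using c K(1) by auto
    fix D :: "real mat" assume D: "D \<in> carrier_mat n q"
    define Z where "Z = A * D * B\<^sup>T"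
    have Z: "Z \<in> carrier_mat m r" using A B D by (auto simp: Z_def)
    have W: "A\<^sup>T * Z * B \<in> carrier_mat n q" using A B Z by auto
    have inner: "frob_inner D (A\<^sup>T * Z * B) = (frob_norm Z)\<^sup>2"
      using frob_inner_two_sided_adjoint[OF A D B Z]
      by (simp add: frob_inner_self flip: Z_def)
    have "(frob_norm (A\<^sup>T * Z * B))\<^sup>2 \<le> (frob_norm A)\<^sup>2 * (frob_norm Z)\<^sup>2 * (frob_norm B)\<^sup>2"
      using frob_norm_mult3_sq_le[of "A\<^sup>T" n m Z r B q] A B Z by (simp add: frob_norm_transpose)
    then have "c\<^sup>2 * (frob_norm (A\<^sup>T * Z * B))\<^sup>2
        \<le> c\<^sup>2 * ((frob_norm A)\<^sup>2 * (frob_norm Z)\<^sup>2 * (frob_norm B)\<^sup>2)"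
      by (intro mult_left_mono) auto
    also have "\<dots> = c * (frob_norm Z)\<^sup>2"
      using pos by (simp add: c_def power2_eq_square[of "1 / _"])
    finally have "(frob_norm (D + - c \<cdot>\<^sub>m (A\<^sup>T * Z * B)))\<^sup>2
        \<le> (frob_norm D)\<^sup>2 - c * (frob_norm Z)\<^sup>2"
      using frob_norm_add_smult_sq[OF D W, of "- c"] inner by simp
    also have "\<dots> \<le> (1 - c / K) * (frob_norm D)\<^sup>2"
    proof -
      have "c / K * (frob_norm D)\<^sup>2 \<le> c / K * (K * (frob_norm Z)\<^sup>2)"
        using K(2)[OF D] c K(1) by (intro mult_left_mono) (auto simp: Z_def)
      then show ?thesis using K(1) by (simp add: algebra_simps)
    qed
    also have "\<dots> \<le> max 0 (1 - c / K) * (frob_norm D)\<^sup>2"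
      by (intro mult_right_mono) auto
    finally show "(frob_norm (D + - c \<cdot>\<^sub>m (A\<^sup>T * (A * D * B\<^sup>T) * B)))\<^sup>2
        \<le> max 0 (1 - c / K) * (frob_norm D)\<^sup>2"
      by (simp add: Z_def)
  qed
qed

text \<open>The residual \<open>R\<close> at the least-squares solution \<open>S\<close> satisfies \<open>A\<^sup>T R B = 0\<close>, so it is orthogonal to every
  \<open>A (X - S) B\<^sup>T\<close> and Pythagoras applies; the lower bound for \<open>D \<mapsto> A D B\<^sup>T\<close> gives uniqueness.\<close>

lemma lsq_solution_is_arg_min_iff:
  assumes A: "A \<in> carrier_mat m n" and B: "B \<in> carrier_mat r q" and Q: "Q \<in> carrier_mat m r"
    and "full_column_rank A" "full_column_rank B" "0 < n" "0 < q"
  shows "is_arg_min (\<lambda>X. (frob_norm (A * X * B\<^sup>T - Q))\<^sup>2) (\<lambda>X. X \<in> carrier_mat n q) X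
    \<longleftrightarrow> X = lsq_solution A B Q"
proof -
  define S where "S = lsq_solution A B Q"
  have S: "S \<in> carrier_mat n q"
    unfolding S_def by (rule lsq_solution_carrier) fact+
  define F where "F X = (frob_norm (A * X * B\<^sup>T - Q))\<^sup>2" for X
  have res0: "A\<^sup>T * residual A B Q S * B = 0\<^sub>m n q"
  proof -
    have "S - S = 0\<^sub>m n q" using S by auto
    then show ?thesis
      using transposed_residual[OF assms(1-5) S] A B by (simp flip: S_def)
  qed
  have pyth: "F X = F S + (frob_norm (A * (X - S) * B\<^sup>T))\<^sup>2" if X: "X \<in> carrier_mat n q" for X
  proof -
    define Y R where "Y = A * (X - S) * B\<^sup>T" and "R = residual A B Q S"
    have XS: "X - S \<in> carrier_mat n q" using X S by auto
    have Y: "Y \<in> carrier_mat m r" and R: "R \<in> carrier_mat m r"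
      using A B Q X S by (auto simp: Y_def R_def residual_def)
    have "A * X * B\<^sup>T - Q = Y + - 1 \<cdot>\<^sub>m R"
    proof -
      have "Y = A * X * B\<^sup>T - A * S * B\<^sup>T"
        unfolding Y_def using A B X S
        by (simp add: mult_minus_distrib_mat[of _ m n _ q] minus_mult_distrib_mat[of _ m q _ _ r])
      then show ?thesis
        unfolding R_def residual_def using A B X S Q by (intro eq_matI) auto
    qed
    moreover have "frob_inner Y R = 0"
      using frob_inner_two_sided_adjoint[OF A XS B R] res0 X S
      by (simp add: Y_def R_def frob_inner_def)
    ultimately have "F X = (frob_norm Y)\<^sup>2 + (frob_norm R)\<^sup>2"
      using frob_norm_add_smult_sq[OF Y R, of "- 1"] by (simp add: F_def)
    moreover have "F S = (frob_norm R)\<^sup>2"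
    proof -
      have "A * S * B\<^sup>T - Q = 0\<^sub>m m r + - 1 \<cdot>\<^sub>m R"
        unfolding R_def residual_def using A B S Q by (intro eq_matI) auto
      then show ?thesis
        using frob_norm_add_smult_sq[OF _ R, of "0\<^sub>m m r" "- 1"]
        by (simp add: F_def frob_norm_sq[of "0\<^sub>m m r"] frob_inner_def)
    qed
    ultimately show ?thesis by (simp add: Y_def)
  qed
  obtain K where K: "0 < K"
    "\<And>D :: real mat. D \<in> carrier_mat n q \<Longrightarrow> (frob_norm D)\<^sup>2 \<le> K * (frob_norm (A * D * B\<^sup>T))\<^sup>2"
    using two_sided_lower_bound[OF assms(1,2,4-7)] by blast
  have uniq: "X = S" if X: "X \<in> carrier_mat n q" and le: "F X \<le> F S" for X
  proof -
    have "(frob_norm (A * (X - S) * B\<^sup>T))\<^sup>2 = 0"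
      using pyth[OF X] le by simp
    then have "(frob_norm (X - S))\<^sup>2 = 0"
      using K(2)[OF minus_carrier_mat[OF S, of X]] by simp
    then have z: "X - S = 0\<^sub>m n q"
      using X S by (intro frob_norm_sq_eq_0_imp_zero) auto
    have "X $$ (i, j) = S $$ (i, j)" if "i < n" "j < q" for i j
      using arg_cong[OF z, of "\<lambda>Y. Y $$ (i, j)"] that X S by simp
    then show ?thesis using X S by (intro eq_matI) auto
  qed
  have "is_arg_min F (\<lambda>X. X \<in> carrier_mat n q) X \<longleftrightarrow> X = S"
    unfolding is_arg_min_def using S uniq pyth
    by (metis le_add_same_cancel1 linorder_not_less zero_le_power2)
  then show ?thesis by (simp add: F_def[abs_def] S_def)
qed

text \<open>The gradient step transforms the error of \<open>E k\<close> by the contraction above, so the error decays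
  geometrically.\<close>

lemma mean_iteration_tendsto:
  assumes A: "A \<in> carrier_mat m n" and B: "B \<in> carrier_mat r q" and Q: "Q \<in> carrier_mat m r"
    and "full_column_rank A" "full_column_rank B"
    and E: "\<And>k. E k \<in> carrier_mat n q"
    and step: "\<And>k. E (Suc k) = E k + 1 / ((frob_norm A)\<^sup>2 * (frob_norm B)\<^sup>2)
      \<cdot>\<^sub>m (A\<^sup>T * residual A B Q (E k) * B)"
    and "i < n" "j < q"
  shows "(\<lambda>k. E k $$ (i, j)) \<longlonglongrightarrow> lsq_solution A B Q $$ (i, j)"
proof -
  define c where "c = 1 / ((frob_norm A)\<^sup>2 * (frob_norm B)\<^sup>2)"
  define S where "S = lsq_solution A B Q"
  define D where "D k = E k - S" for k
  have S: "S \<in> carrier_mat n q"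
    unfolding S_def by (rule lsq_solution_carrier) fact+
  have D: "D k \<in> carrier_mat n q" for k using E S by (auto simp: D_def)
  have "0 < n" "0 < q" using assms by auto
  obtain \<rho> where \<rho>: "0 \<le> \<rho>" "\<rho> < 1"
    "\<And>D :: real mat. D \<in> carrier_mat n q \<Longrightarrow>
      (frob_norm (D + - c \<cdot>\<^sub>m (A\<^sup>T * (A * D * B\<^sup>T) * B)))\<^sup>2 \<le> \<rho> * (frob_norm D)\<^sup>2"
    using normal_operator_contraction[OF A B assms(4,5) \<open>0 < n\<close> \<open>0 < q\<close>, folded c_def] by blast
  have Dstep: "D (Suc k) = D k + - c \<cdot>\<^sub>m (A\<^sup>T * (A * D k * B\<^sup>T) * B)" for k
  proof -
    have "E (Suc k) = E k + c \<cdot>\<^sub>m (- 1 \<cdot>\<^sub>m (A\<^sup>T * (A * D k * B\<^sup>T) * B))"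
      using step[of k] transposed_residual[OF assms(1-5) E[of k]] by (simp add: c_def D_def S_def)
    then show ?thesis
      unfolding D_def[of "Suc k"] using E[of k] S A B D[of k]
      by (intro eq_matI) (auto simp: D_def[of k])
  qed
  have bound: "(frob_norm (D k))\<^sup>2 \<le> \<rho> ^ k * (frob_norm (D 0))\<^sup>2" for k
  proof (induction k)
    case (Suc k)
    have "(frob_norm (D (Suc k)))\<^sup>2 \<le> \<rho> * (frob_norm (D k))\<^sup>2"
      unfolding Dstep by (rule \<rho>(3)) (rule D)
    also have "\<dots> \<le> \<rho> * (\<rho> ^ k * (frob_norm (D 0))\<^sup>2)"
      using Suc \<rho>(1) by (intro mult_left_mono)
    finally show ?case by (simp add: mult_ac)
  qed simp
  have "(\<lambda>k. (D k $$ (i, j))\<^sup>2) \<longlonglongrightarrow> 0"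
  proof (rule tendsto_sandwich[OF _ _ tendsto_const])
    show "(\<lambda>k. \<rho> ^ k * (frob_norm (D 0))\<^sup>2) \<longlonglongrightarrow> 0"
      using \<rho> by (intro tendsto_mult_left_zero LIMSEQ_realpow_zero)
    show "\<forall>\<^sub>F k in sequentially. (D k $$ (i, j))\<^sup>2 \<le> \<rho> ^ k * (frob_norm (D 0))\<^sup>2"
      using assms(8,9) D by (intro always_eventually allI order_trans[OF entry_sq_le_frob_norm_sq bound])
        (auto simp: carrier_matD[OF D])
  qed auto
  then have "(\<lambda>k. D k $$ (i, j)) \<longlonglongrightarrow> 0"
    using tendsto_real_sqrt[of "\<lambda>k. (D k $$ (i, j))\<^sup>2" 0] by (simp add: tendsto_rabs_zero_iff)
  then have "(\<lambda>k. E k $$ (i, j) - S $$ (i, j)) \<longlonglongrightarrow> 0"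
    using assms(8,9) E S by (simp add: D_def)
  then show ?thesis by (simp add: LIM_zero_iff S_def)
qed

section \<open>Entrywise form of the iteration\<close>

text \<open>Written out over the entries of \<open>X\<close>, so that measurability, integrability and expectation can be
  passed through term by term.\<close>

lemma residual_entry_affine:
  assumes A: "A \<in> carrier_mat m n" and B: "B \<in> carrier_mat r q" and Q: "Q \<in> carrier_mat m r"
    and X: "X \<in> carrier_mat n q" and "i < n" "j < q"
  shows "(A\<^sup>T * residual A B Q X * B) $$ (i, j) = (A\<^sup>T * Q * B) $$ (i, j)
    - (\<Sum>k<n. \<Sum>l<q. (A\<^sup>T * A) $$ (i, k) * X $$ (k, l) * (B\<^sup>T * B) $$ (l, j))"
proof -
  have "(A\<^sup>T * residual A B Q X * B) $$ (i, j)
      = (A\<^sup>T * Q * B) $$ (i, j) - (A\<^sup>T * A * X * (B\<^sup>T * B)) $$ (i, j)"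
    unfolding residual_sandwich[OF A B Q X]
    using A B Q X assms(5,6) by (intro index_minus_mat(1)) auto
  also have "(A\<^sup>T * A * X * (B\<^sup>T * B)) $$ (i, j)
      = (\<Sum>k<n. \<Sum>l<q. (A\<^sup>T * A) $$ (i, k) * X $$ (k, l) * (B\<^sup>T * B) $$ (l, j))"
    using A B X assms(5,6) by (intro index_mult_mat_sum3) auto
  finally show ?thesis .
qed

lemma cols_sub_carrier:
  "cols_sub A U \<in> carrier_mat (dim_row A) (card {j. j < dim_col A \<and> j \<in> U})"
  by (auto simp: cols_sub_def dim_submatrix)

lemma cols_sub_index:
  assumes "h < dim_row A" "i < dim_col A" "i \<in> U"
  shows "cols_sub A U $$ (h, card {a \<in> U. a < i}) = A $$ (h, i)"
  using submatrix_index_card[OF assms(1,2) UNIV_I assms(3)] by (simp add: cols_sub_def)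

lemma card_below_less:
  assumes "i < n" "i \<in> U"
  shows "card {a \<in> U. a < i} < card {j. j < n \<and> j \<in> (U :: nat set)}"
  using assms by (intro psubset_card_mono) auto

text \<open>A block update computes exactly the entries of the full descent direction \<open>A\<^sup>T R B\<close> that it
  overwrites, since column \<open>i\<close> of \<open>A\<close> is column \<open>card {a \<in> U. a < i}\<close> of the block.\<close>

lemma block_product_entry:
  assumes A: "A \<in> carrier_mat m n" and B: "B \<in> carrier_mat r q" and R: "R \<in> carrier_mat m r"
    and "i < n" "i \<in> U" "j < q" "j \<in> V"
  shows "((cols_sub A U)\<^sup>T * R * cols_sub B V) $$ (card {a \<in> U. a < i}, card {b \<in> V. b < j})
    = (A\<^sup>T * R * B) $$ (i, j)"
proof -
  define n' q' where "n' = card {j. j < n \<and> j \<in> U}" and "q' = card {j. j < q \<and> j \<in> V}"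
  define i' j' where "i' = card {a \<in> U. a < i}" and "j' = card {b \<in> V. b < j}"
  have C: "cols_sub A U \<in> carrier_mat m n'" "cols_sub B V \<in> carrier_mat r q'"
    using cols_sub_carrier[of A U] cols_sub_carrier[of B V] A B by (auto simp: n'_def q'_def)
  have i': "i' < n'" and j': "j' < q'"
    using assms by (simp_all add: i'_def n'_def j'_def q'_def card_below_less)
  have "((cols_sub A U)\<^sup>T * R * cols_sub B V) $$ (i', j')
      = (\<Sum>k<m. \<Sum>l<r. (cols_sub A U)\<^sup>T $$ (i', k) * R $$ (k, l) * cols_sub B V $$ (l, j'))"
    using C R i' j' by (intro index_mult_mat_sum3) auto
  also have "\<dots> = (\<Sum>k<m. \<Sum>l<r. A\<^sup>T $$ (i, k) * R $$ (k, l) * B $$ (l, j))"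
    using C i' j' assms
    by (intro sum.cong refl) (auto simp: i'_def j'_def cols_sub_index)
  also have "\<dots> = (A\<^sup>T * R * B) $$ (i, j)"
    using A B R assms by (intro index_mult_mat_sum3[symmetric]) auto
  finally show ?thesis by (simp add: i'_def j'_def)
qed

text \<open>The probability of a block is proportional to the weight by which its update divides, so the
  two cancel in the mean. This survives a vanishing weight, where the division yields \<open>0\<close>: the
  block of \<open>A\<^sup>T R B\<close> then vanishes as well.\<close>

lemma block_weight_cancel:
  assumes A: "A \<in> carrier_mat m n" and B: "B \<in> carrier_mat r q" and R: "R \<in> carrier_mat m r"
    and "i < n" "i \<in> U" "j < q" "j \<in> V"
  defines "w \<equiv> (frob_norm (cols_sub A U))\<^sup>2 * (frob_norm (cols_sub B V))\<^sup>2"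
  shows "w * (1 / w * (A\<^sup>T * R * B) $$ (i, j)) = (A\<^sup>T * R * B) $$ (i, j)"
proof (cases "w = 0")
  case True
  define n' q' where "n' = card {j. j < n \<and> j \<in> U}" and "q' = card {j. j < q \<and> j \<in> V}"
  define W where "W = (cols_sub A U)\<^sup>T * R * cols_sub B V"
  have C: "cols_sub A U \<in> carrier_mat m n'" "cols_sub B V \<in> carrier_mat r q'"
    using cols_sub_carrier[of A U] cols_sub_carrier[of B V] A B by (auto simp: n'_def q'_def)
  have "(frob_norm W)\<^sup>2
      \<le> (frob_norm (cols_sub A U)\<^sup>T)\<^sup>2 * (frob_norm R)\<^sup>2 * (frob_norm (cols_sub B V))\<^sup>2"
    unfolding W_def using C R by (intro frob_norm_mult3_sq_le) auto
  also have "\<dots> = 0" using True by (auto simp: w_def frob_norm_transpose)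
  finally have "(frob_norm W)\<^sup>2 \<le> 0" .
  moreover have "(W $$ (card {a \<in> U. a < i}, card {b \<in> V. b < j}))\<^sup>2 \<le> (frob_norm W)\<^sup>2"
    using C assms by (intro entry_sq_le_frob_norm_sq) (auto simp: W_def n'_def q'_def card_below_less)
  ultimately have "((A\<^sup>T * R * B) $$ (i, j))\<^sup>2 \<le> 0"
    using block_product_entry[OF assms(1-7)] unfolding W_def by (metis order_trans)
  then show ?thesis by simp
qed simp

lemma coord_carrier: "P \<in> carrier_mat m n \<Longrightarrow> coord f P \<in> carrier_mat m n"
  by (simp add: coord_def)

lemma coord_of_coords:
  assumes "i < m" "j < n"
  shows "coord f (of_coords m n X) $$ (i, j) = X f $$ (i, j)"
  using assms by (simp add: coord_def of_coords_def)

lemma block_update_entry: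
  assumes A: "A \<in> carrier_mat m n" and B: "B \<in> carrier_mat r q" and Q: "Q \<in> carrier_mat m r"
    and X: "X \<in> carrier_mat n q" and "i < n" "j < q"
  shows "block_update A B Q U V X $$ (i, j) = X $$ (i, j) + of_bool (i \<in> U) * of_bool (j \<in> V)
    * (1 / ((frob_norm (cols_sub A U))\<^sup>2 * (frob_norm (cols_sub B V))\<^sup>2)
       * (A\<^sup>T * residual A B Q X * B) $$ (i, j))"
proof (cases "i \<in> U \<and> j \<in> V")
  case True
  define R where "R = residual A B Q X"
  have R: "R \<in> carrier_mat m r" using A B Q X by (auto simp: R_def residual_def)
  have "block_increment A B R U V $$ (card {a \<in> U. a < i}, card {b \<in> V. b < j})
      = 1 / ((frob_norm (cols_sub A U))\<^sup>2 * (frob_norm (cols_sub B V))\<^sup>2)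
        * ((cols_sub A U)\<^sup>T * R * cols_sub B V) $$ (card {a \<in> U. a < i}, card {b \<in> V. b < j})"
    unfolding block_increment_def using True assms cols_sub_carrier[of A U] cols_sub_carrier[of B V]
    by (intro index_smult_mat(1)) (auto simp: card_below_less)
  then show ?thesis
    using True assms block_product_entry[OF A B R, of i U j V]
    by (simp add: block_update_def R_def)
next
  case False
  then show ?thesis using assms by (auto simp: block_update_def)
qed

lemma indexed_partition_block:
  assumes "indexed_partition U t n" "i \<le> n"
  obtains a where "a \<le> t" "i \<in> U a" "\<And>l. l \<le> t \<Longrightarrow> i \<in> U l \<longleftrightarrow> l = a"
proof -
  from assms obtain a where a: "a \<le> t" "i \<in> U a"
    by (auto simp: indexed_partition_def)
  moreover have "l = a" if "l \<le> t" "i \<in> U l" for l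
    using assms that a unfolding indexed_partition_def disjoint_family_on_def by blast
  ultimately show thesis using that by blast
qed

text \<open>The first \<open>k\<close> steps use only the first \<open>k\<close> draws; this is what makes draw number \<open>k\<close> independent
  of the current control points.\<close>

lemma rpia_cong:
  assumes "\<And>l. l < k \<Longrightarrow> \<tau> l = \<tau>' l" "\<And>l. l < k \<Longrightarrow> \<sigma> l = \<sigma>' l"
  shows "rpia A B Q U V P0 \<tau> \<sigma> k = rpia A B Q U V P0 \<tau>' \<sigma>' k"
  using assms by (induction k) (simp_all add: Let_def)

lemma rpia_carrier:
  "P0 \<in> carrier_mat n q \<Longrightarrow> rpia A B Q U V P0 \<tau> \<sigma> k \<in> carrier_mat n q"
  by (induction k) (auto simp: Let_def of_coords_def)

lemma vec_eq_sum_coords: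
  assumes "i < dim_row P" "j < dim_col P"
  shows "P $$ (i, j) = (\<Sum>f\<in>UNIV. coord f P $$ (i, j) *\<^sub>R axis f 1)"
  using assms basis_expansion[of "P $$ (i, j)"] by (simp add: coord_def scalar_mult_eq_scaleR)

text \<open>Reduces statements on points of space to statements on the real coordinates.\<close>

lemma surface_eq_sum_coords:
  assumes "P \<in> carrier_mat (n1 + 1) (n2 + 1)"
  shows "surface \<mu> v n1 n2 P x y = (\<Sum>i\<le>n1. \<Sum>j\<le>n2. \<Sum>f\<in>UNIV.
    (\<mu> i x * v j y * coord f P $$ (i, j)) *\<^sub>R axis f 1)"
  unfolding surface_def using assms
  by (intro sum.cong refl) (subst vec_eq_sum_coords, auto simp: scaleR_sum_right)

locale rpia_setting =
  fixes A B :: "real mat" and Q P0 :: "(real ^ 3) mat" and U V :: "nat \<Rightarrow> nat set"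
    and m r n1 n2 t s :: nat
  assumes A: "A \<in> carrier_mat m (n1 + 1)" and B: "B \<in> carrier_mat r (n2 + 1)"
    and Q: "Q \<in> carrier_mat m r" and P0: "P0 \<in> carrier_mat (n1 + 1) (n2 + 1)"
    and U: "indexed_partition U t n1" and V: "indexed_partition V s n2"
begin

abbreviation iter :: "(nat \<Rightarrow> nat) \<Rightarrow> (nat \<Rightarrow> nat) \<Rightarrow> nat \<Rightarrow> (real ^ 3) mat" where
  "iter \<equiv> rpia A B Q U V P0"

abbreviation grad :: "3 \<Rightarrow> real mat \<Rightarrow> real mat" where
  "grad f X \<equiv> A\<^sup>T * residual A B (coord f Q) X * B"

definition block_weight :: "nat \<Rightarrow> nat \<Rightarrow> real" where
  "block_weight a b = (frob_norm (cols_sub A (U a)))\<^sup>2 * (frob_norm (cols_sub B (V b)))\<^sup>2"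

lemma iter_carrier: "coord f (iter \<tau> \<sigma> k) \<in> carrier_mat (n1 + 1) (n2 + 1)"
  by (intro coord_carrier rpia_carrier P0)

lemma coord_Q: "coord f Q \<in> carrier_mat m r"
  by (intro coord_carrier Q)

lemma grad_entry:
  assumes "X \<in> carrier_mat (n1 + 1) (n2 + 1)" "i \<le> n1" "j \<le> n2"
  shows "grad f X $$ (i, j) = (A\<^sup>T * coord f Q * B) $$ (i, j)
    - (\<Sum>k<n1 + 1. \<Sum>l<n2 + 1. (A\<^sup>T * A) $$ (i, k) * X $$ (k, l) * (B\<^sup>T * B) $$ (l, j))"
  using residual_entry_affine[OF A B coord_Q[of f] assms(1), of i j] assms(2,3) by simp

lemma grad_measurable:
  assumes "\<And>\<omega>. X \<omega> \<in> carrier_mat (n1 + 1) (n2 + 1)"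
    and "\<And>i j. i \<le> n1 \<Longrightarrow> j \<le> n2 \<Longrightarrow> (\<lambda>\<omega>. X \<omega> $$ (i, j)) \<in> borel_measurable N"
    and "i \<le> n1" "j \<le> n2"
  shows "(\<lambda>\<omega>. grad f (X \<omega>) $$ (i, j)) \<in> borel_measurable N"
  unfolding grad_entry[OF assms(1,3,4)]
  by (intro borel_measurable_diff borel_measurable_sum borel_measurable_times
      borel_measurable_const assms(2)) auto

text \<open>Each entry lies in exactly one block, so its update is switched on by a single event. This turns
  the set-indexed update into a product of an indicator of the new draw and a function of the past.\<close>

lemma iter_Suc_entry:
  assumes "i \<le> n1" "j \<le> n2" "\<tau> k \<le> t" "\<sigma> k \<le> s"
    and "\<And>l. l \<le> t \<Longrightarrow> i \<in> U l \<longleftrightarrow> l = a" "\<And>l. l \<le> s \<Longrightarrow> j \<in> V l \<longleftrightarrow> l = b"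
  shows "coord f (iter \<tau> \<sigma> (Suc k)) $$ (i, j) = coord f (iter \<tau> \<sigma> k) $$ (i, j)
    + of_bool (\<tau> k = a) * of_bool (\<sigma> k = b)
      * (1 / block_weight a b * grad f (coord f (iter \<tau> \<sigma> k)) $$ (i, j))"
proof -
  have c: "iter \<tau> \<sigma> k \<in> carrier_mat (n1 + 1) (n2 + 1)" by (rule rpia_carrier[OF P0])
  have "coord f (iter \<tau> \<sigma> (Suc k)) $$ (i, j)
      = block_update A B (coord f Q) (U (\<tau> k)) (V (\<sigma> k)) (coord f (iter \<tau> \<sigma> k)) $$ (i, j)"
    using c assms(1,2) by (simp add: Let_def coord_of_coords)
  also have "\<dots> = coord f (iter \<tau> \<sigma> k) $$ (i, j)
    + of_bool (i \<in> U (\<tau> k)) * of_bool (j \<in> V (\<sigma> k))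
      * (1 / block_weight (\<tau> k) (\<sigma> k) * grad f (coord f (iter \<tau> \<sigma> k)) $$ (i, j))"
    unfolding block_weight_def using assms(1,2)
    by (intro block_update_entry[OF A B coord_Q iter_carrier]) auto
  finally show ?thesis using assms(3-6) by (auto simp: of_bool_def)
qed

text \<open>The draws are measurable functions on an arbitrary space: independence of the next draw is
  obtained on a product space, whose coordinates then play the role of the draws.\<close>

lemma iter_measurable:
  assumes "\<And>l. l < k \<Longrightarrow> \<tau> l \<in> measurable N (count_space {..t})"
    and "\<And>l. l < k \<Longrightarrow> \<sigma> l \<in> measurable N (count_space {..s})"
    and "i \<le> n1" "j \<le> n2"
  shows "(\<lambda>\<omega>. coord f (iter (\<lambda>l. \<tau> l \<omega>) (\<lambda>l. \<sigma> l \<omega>) k) $$ (i, j)) \<in> borel_measurable N"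
  using assms
proof (induction k arbitrary: i j)
  case 0
  then show ?case by simp
next
  case (Suc k)
  let ?X = "\<lambda>\<omega>. coord f (iter (\<lambda>l. \<tau> l \<omega>) (\<lambda>l. \<sigma> l \<omega>) k)"
  obtain a where a: "\<And>l. l \<le> t \<Longrightarrow> i \<in> U l \<longleftrightarrow> l = a"
    using indexed_partition_block[OF U Suc.prems(3)] by metis
  obtain b where b: "\<And>l. l \<le> s \<Longrightarrow> j \<in> V l \<longleftrightarrow> l = b"
    using indexed_partition_block[OF V Suc.prems(4)] by metis
  have \<tau>: "\<tau> k \<in> measurable N (count_space {..t})" and \<sigma>: "\<sigma> k \<in> measurable N (count_space {..s})"
    using Suc.prems by auto
  have X [measurable]: "(\<lambda>\<omega>. ?X \<omega> $$ (i, j)) \<in> borel_measurable N" if "i \<le> n1" "j \<le> n2" for i j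
    using that Suc by auto
  have [measurable]: "(\<lambda>\<omega>. of_bool (\<tau> k \<omega> = a) :: real) \<in> borel_measurable N"
    "(\<lambda>\<omega>. of_bool (\<sigma> k \<omega> = b) :: real) \<in> borel_measurable N"
    by (intro measurable_compose[OF \<tau>] measurable_compose[OF \<sigma>] measurable_count_space_eq1[THEN iffD2]; simp)+
  have [measurable]: "(\<lambda>\<omega>. grad f (?X \<omega>) $$ (i, j)) \<in> borel_measurable N"
    using X Suc.prems(3,4) by (intro grad_measurable iter_carrier)
  have [measurable]: "(\<lambda>\<omega>. ?X \<omega> $$ (i, j)) \<in> borel_measurable N"
    using X Suc.prems by auto
  have "(\<lambda>\<omega>. ?X \<omega> $$ (i, j) + of_bool (\<tau> k \<omega> = a) * of_bool (\<sigma> k \<omega> = b)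
      * (1 / block_weight a b * grad f (?X \<omega>) $$ (i, j))) \<in> borel_measurable N"
    by measurable
  moreover have "coord f (iter (\<lambda>l. \<tau> l \<omega>) (\<lambda>l. \<sigma> l \<omega>) (Suc k)) $$ (i, j)
      = ?X \<omega> $$ (i, j) + of_bool (\<tau> k \<omega> = a) * of_bool (\<sigma> k \<omega> = b)
        * (1 / block_weight a b * grad f (?X \<omega>) $$ (i, j))" if "\<omega> \<in> space N" for \<omega>
    using measurable_space[OF \<tau> that] measurable_space[OF \<sigma> that] Suc.prems a b
    by (intro iter_Suc_entry) auto
  ultimately show ?case
    by (subst measurable_cong) auto
qed

end

section \<open>The mean of the random iteration\<close>

locale rpia_process = rpia_setting A B Q P0 U V m r n1 n2 t s + prob_space M
  for A B :: "real mat" and Q P0 :: "(real ^ 3) mat" and U V :: "nat \<Rightarrow> nat set"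
    and m r n1 n2 t s :: nat and M :: "'w measure" +
  fixes T S :: "nat \<Rightarrow> 'w \<Rightarrow> nat"
  assumes draws: "rpia_draws M A B t U s V T S"
begin

abbreviation draw_space :: "nat + nat \<Rightarrow> nat measure" where
  "draw_space \<equiv> case_sum (\<lambda>_. count_space {..t}) (\<lambda>_. count_space {..s})"

lemma draws_indep: "indep_vars draw_space (case_sum T S) UNIV"
  using draws by (simp add: rpia_draws_def)

lemma T_measurable: "T k \<in> measurable M (count_space {..t})"
  and S_measurable: "S k \<in> measurable M (count_space {..s})"
proof -
  have *: "case_sum T S i \<in> measurable M (draw_space i)" for i
    using draws_indep by (simp add: indep_vars_def2)
  show "T k \<in> measurable M (count_space {..t})" "S k \<in> measurable M (count_space {..s})"
    using *[of "Inl k"] *[of "Inr k"] by simp_all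
qed

lemma T_le: "\<omega> \<in> space M \<Longrightarrow> T k \<omega> \<le> t"
  using measurable_space[OF T_measurable] by auto

lemma S_le: "\<omega> \<in> space M \<Longrightarrow> S k \<omega> \<le> s"
  using measurable_space[OF S_measurable] by auto

abbreviation ctrl :: "3 \<Rightarrow> nat \<Rightarrow> 'w \<Rightarrow> real mat" where
  "ctrl f k \<omega> \<equiv> coord f (iter (\<lambda>l. T l \<omega>) (\<lambda>l. S l \<omega>) k)"

lemma prob_draw:
  assumes "a \<le> t" "b \<le> s"
  shows "prob {\<omega> \<in> space M. T k \<omega> = a \<and> S k \<omega> = b}
    = block_weight a b / ((frob_norm A)\<^sup>2 * (frob_norm B)\<^sup>2)"
proof -
  have "prob (\<Inter>i\<in>{Inl k, Inr k}. case_sum T S i -` case_sum (\<lambda>_. {a}) (\<lambda>_. {b}) i \<inter> space M)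
      = (\<Prod>i\<in>{Inl k, Inr k}. prob (case_sum T S i -` case_sum (\<lambda>_. {a}) (\<lambda>_. {b}) i \<inter> space M))"
    using assms by (intro indep_varsD[OF draws_indep]) auto
  also have "(\<Inter>i\<in>{Inl k, Inr k}. case_sum T S i -` case_sum (\<lambda>_. {a}) (\<lambda>_. {b}) i \<inter> space M)
      = {\<omega> \<in> space M. T k \<omega> = a \<and> S k \<omega> = b}"
    by auto
  also have "(\<Prod>i\<in>{Inl k, Inr k}. prob (case_sum T S i -` case_sum (\<lambda>_. {a}) (\<lambda>_. {b}) i \<inter> space M))
      = prob {\<omega> \<in> space M. T k \<omega> = a} * prob {\<omega> \<in> space M. S k \<omega> = b}"
    by (simp add: vimage_def Int_def conj_commute)
  finally show ?thesis
    using draws assms by (simp add: rpia_draws_def block_weight_def)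
qed

lemma draw_indicator_measurable:
  "(\<lambda>\<omega>. of_bool (T k \<omega> = a) * of_bool (S k \<omega> = b) :: real) \<in> borel_measurable M"
  by (intro borel_measurable_times measurable_compose[OF T_measurable]
      measurable_compose[OF S_measurable] measurable_count_space_eq1[THEN iffD2]; simp)

lemma draw_indicator_integrable:
  "integrable M (\<lambda>\<omega>. of_bool (T k \<omega> = a) * of_bool (S k \<omega> = b) :: real)"
  by (rule integrable_const_bound[where B = 1, OF _ draw_indicator_measurable]) auto

lemma expectation_draw_indicator:
  assumes "a \<le> t" "b \<le> s"
  shows "expectation (\<lambda>\<omega>. of_bool (T k \<omega> = a) * of_bool (S k \<omega> = b))
    = block_weight a b / ((frob_norm A)\<^sup>2 * (frob_norm B)\<^sup>2)"
proof -
  let ?E = "{\<omega> \<in> space M. T k \<omega> = a \<and> S k \<omega> = b}"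
  have "?E = (T k -` {a} \<inter> space M) \<inter> (S k -` {b} \<inter> space M)" by auto
  also have "\<dots> \<in> events"
    using assms by (intro sets.Int measurable_sets[OF T_measurable] measurable_sets[OF S_measurable]) auto
  finally have "expectation (indicator ?E :: _ \<Rightarrow> real) = prob ?E" by simp
  moreover have "expectation (\<lambda>\<omega>. of_bool (T k \<omega> = a) * of_bool (S k \<omega> = b))
      = expectation (indicator ?E :: _ \<Rightarrow> real)"
    by (intro Bochner_Integration.integral_cong) (auto simp: indicator_def)
  ultimately show ?thesis using prob_draw[OF assms] by simp
qed

text \<open>The draw of step \<open>k\<close> and the current control points are functions of disjoint sets of the
  independent draws.\<close>

lemma grad_indep_draw:
  assumes "i \<le> n1" "j \<le> n2"
  shows "indep_var borel (\<lambda>\<omega>. of_bool (T k \<omega> = a) * of_bool (S k \<omega> = b) :: real)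
    borel (\<lambda>\<omega>. grad f (ctrl f k \<omega>) $$ (i, j))"
proof -
  define J J' :: "(nat + nat) set" where "J = {Inl k, Inr k}" and "J' = Inl ` {..<k} \<union> Inr ` {..<k}"
  define Y1 :: "(nat + nat \<Rightarrow> nat) \<Rightarrow> real"
    where "Y1 z = of_bool (z (Inl k) = a) * of_bool (z (Inr k) = b)" for z
  define Y2 :: "(nat + nat \<Rightarrow> nat) \<Rightarrow> real"
    where "Y2 z = grad f (coord f (iter (\<lambda>l. z (Inl l)) (\<lambda>l. z (Inr l)) k)) $$ (i, j)" for z
  have comp: "(\<lambda>z. z l) \<in> measurable (PiM I draw_space) (draw_space l)" if "l \<in> I" for l I
    using that by (rule measurable_component_singleton)
  have cl: "(\<lambda>z. z (Inl l)) \<in> measurable (PiM I draw_space) (count_space {..t})" if "Inl l \<in> I" for l I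
    using comp[OF that] by simp
  have cr: "(\<lambda>z. z (Inr l)) \<in> measurable (PiM I draw_space) (count_space {..s})" if "Inr l \<in> I" for l I
    using comp[OF that] by simp
  have "indep_var (PiM J draw_space) (\<lambda>\<omega>. restrict (\<lambda>l. case_sum T S l \<omega>) J)
      (PiM J' draw_space) (\<lambda>\<omega>. restrict (\<lambda>l. case_sum T S l \<omega>) J')"
    by (rule indep_var_restrict[OF draws_indep]) (auto simp: J_def J'_def)
  moreover have "Y1 \<in> borel_measurable (PiM J draw_space)"
    unfolding Y1_def
    by (intro borel_measurable_times measurable_compose[OF cl] measurable_compose[OF cr]
        measurable_count_space_eq1[THEN iffD2]; simp add: J_def)
  moreover have "Y2 \<in> borel_measurable (PiM J' draw_space)"
    unfolding Y2_def using assms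
    by (intro grad_measurable iter_carrier iter_measurable cl cr) (auto simp: J'_def)
  ultimately have "indep_var borel (Y1 \<circ> (\<lambda>\<omega>. restrict (\<lambda>l. case_sum T S l \<omega>) J))
      borel (Y2 \<circ> (\<lambda>\<omega>. restrict (\<lambda>l. case_sum T S l \<omega>) J'))"
    by (rule indep_var_compose)
  also have "Y1 \<circ> (\<lambda>\<omega>. restrict (\<lambda>l. case_sum T S l \<omega>) J)
      = (\<lambda>\<omega>. of_bool (T k \<omega> = a) * of_bool (S k \<omega> = b))"
    by (simp add: Y1_def J_def fun_eq_iff)
  also have "Y2 \<circ> (\<lambda>\<omega>. restrict (\<lambda>l. case_sum T S l \<omega>) J') = (\<lambda>\<omega>. grad f (ctrl f k \<omega>) $$ (i, j))"
  proof
    fix \<omega>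
    have "iter (\<lambda>l. restrict (\<lambda>l. case_sum T S l \<omega>) J' (Inl l))
        (\<lambda>l. restrict (\<lambda>l. case_sum T S l \<omega>) J' (Inr l)) k = iter (\<lambda>l. T l \<omega>) (\<lambda>l. S l \<omega>) k"
      by (rule rpia_cong) (auto simp: J'_def)
    then show "(Y2 \<circ> (\<lambda>\<omega>. restrict (\<lambda>l. case_sum T S l \<omega>) J')) \<omega> = grad f (ctrl f k \<omega>) $$ (i, j)"
      by (simp add: Y2_def)
  qed
  finally show ?thesis .
qed

definition mean_ctrl :: "3 \<Rightarrow> nat \<Rightarrow> real mat" where
  "mean_ctrl f k = mat (n1 + 1) (n2 + 1) (\<lambda>(i, j). expectation (\<lambda>\<omega>. ctrl f k \<omega> $$ (i, j)))"

lemma mean_ctrl_carrier: "mean_ctrl f k \<in> carrier_mat (n1 + 1) (n2 + 1)"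
  by (simp add: mean_ctrl_def)

text \<open>The descent direction is affine in the control points, so it commutes with the expectation.\<close>

lemma mean_grad:
  assumes int: "\<And>i j. i \<le> n1 \<Longrightarrow> j \<le> n2 \<Longrightarrow> integrable M (\<lambda>\<omega>. ctrl f k \<omega> $$ (i, j))"
    and "i \<le> n1" "j \<le> n2"
  shows "integrable M (\<lambda>\<omega>. grad f (ctrl f k \<omega>) $$ (i, j))"
    and "expectation (\<lambda>\<omega>. grad f (ctrl f k \<omega>) $$ (i, j)) = grad f (mean_ctrl f k) $$ (i, j)"
proof -
  let ?h = "\<lambda>x l \<omega>. (A\<^sup>T * A) $$ (i, x) * ctrl f k \<omega> $$ (x, l) * (B\<^sup>T * B) $$ (l, j)"
  have 1: "integrable M (?h x l)" if "x < n1 + 1" "l < n2 + 1" for x l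
    using int[of x l] that by simp
  have 2: "integrable M (\<lambda>\<omega>. \<Sum>x<n1 + 1. \<Sum>l<n2 + 1. ?h x l \<omega>)"
    using 1 by (intro Bochner_Integration.integrable_sum) auto
  show "integrable M (\<lambda>\<omega>. grad f (ctrl f k \<omega>) $$ (i, j))"
    unfolding grad_entry[OF iter_carrier assms(2,3)]
    by (intro Bochner_Integration.integrable_diff integrable_const 2)
  have "expectation (\<lambda>\<omega>. grad f (ctrl f k \<omega>) $$ (i, j))
      = (A\<^sup>T * coord f Q * B) $$ (i, j) - expectation (\<lambda>\<omega>. \<Sum>x<n1 + 1. \<Sum>l<n2 + 1. ?h x l \<omega>)"
    unfolding grad_entry[OF iter_carrier assms(2,3)] using 2 by (simp add: prob_space)
  also have "expectation (\<lambda>\<omega>. \<Sum>x<n1 + 1. \<Sum>l<n2 + 1. ?h x l \<omega>)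
      = (\<Sum>x<n1 + 1. \<Sum>l<n2 + 1. expectation (?h x l))"
    using 1 by (subst Bochner_Integration.integral_sum; (intro sum.cong refl Bochner_Integration.integral_sum Bochner_Integration.integrable_sum)?) auto
  also have "\<dots> = (\<Sum>x<n1 + 1. \<Sum>l<n2 + 1.
      (A\<^sup>T * A) $$ (i, x) * mean_ctrl f k $$ (x, l) * (B\<^sup>T * B) $$ (l, j))"
    by (intro sum.cong refl) (simp add: mean_ctrl_def)
  finally show "expectation (\<lambda>\<omega>. grad f (ctrl f k \<omega>) $$ (i, j)) = grad f (mean_ctrl f k) $$ (i, j)"
    unfolding grad_entry[OF mean_ctrl_carrier assms(2,3)] .
qed

text \<open>By independence the mean of the increment is the probability of the block times the mean of the
  update, and the block weight cancels: in the mean every step is the same full gradient step,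
  whichever partition is used.\<close>

lemma ctrl_step:
  assumes int: "\<And>i j. i \<le> n1 \<Longrightarrow> j \<le> n2 \<Longrightarrow> integrable M (\<lambda>\<omega>. ctrl f k \<omega> $$ (i, j))"
    and ij: "i \<le> n1" "j \<le> n2"
  shows "integrable M (\<lambda>\<omega>. ctrl f (Suc k) \<omega> $$ (i, j))"
    and "expectation (\<lambda>\<omega>. ctrl f (Suc k) \<omega> $$ (i, j)) = mean_ctrl f k $$ (i, j)
      + 1 / ((frob_norm A)\<^sup>2 * (frob_norm B)\<^sup>2) * grad f (mean_ctrl f k) $$ (i, j)"
proof -
  obtain a where a: "a \<le> t" "i \<in> U a" "\<And>l. l \<le> t \<Longrightarrow> i \<in> U l \<longleftrightarrow> l = a"
    using indexed_partition_block[OF U ij(1)] by metis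
  obtain b where b: "b \<le> s" "j \<in> V b" "\<And>l. l \<le> s \<Longrightarrow> j \<in> V l \<longleftrightarrow> l = b"
    using indexed_partition_block[OF V ij(2)] by metis
  define \<chi> g where "\<chi> \<omega> = (of_bool (T k \<omega> = a) * of_bool (S k \<omega> = b) :: real)"
    and "g \<omega> = grad f (ctrl f k \<omega>) $$ (i, j)" for \<omega>
  have step: "ctrl f (Suc k) \<omega> $$ (i, j) = ctrl f k \<omega> $$ (i, j) + 1 / block_weight a b * (\<chi> \<omega> * g \<omega>)"
    if "\<omega> \<in> space M" for \<omega>
    using iter_Suc_entry[of i j "\<lambda>l. T l \<omega>" k "\<lambda>l. S l \<omega>" a b f] ij T_le[OF that] S_le[OF that] a b
    by (simp add: \<chi>_def g_def)
  have ind: "indep_var borel \<chi> borel g"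
    unfolding \<chi>_def g_def by (rule grad_indep_draw[OF ij])
  have \<chi>: "integrable M \<chi>"
    unfolding \<chi>_def by (rule draw_indicator_integrable)
  have g: "integrable M g" "expectation g = grad f (mean_ctrl f k) $$ (i, j)"
    unfolding g_def by (rule mean_grad[OF int ij], assumption+)+
  have \<chi>g: "integrable M (\<lambda>\<omega>. \<chi> \<omega> * g \<omega>)"
    by (rule indep_var_integrable[OF ind \<chi> g(1)])
  have "integrable M (\<lambda>\<omega>. ctrl f k \<omega> $$ (i, j) + 1 / block_weight a b * (\<chi> \<omega> * g \<omega>))"
    by (intro Bochner_Integration.integrable_add int ij integrable_mult_right \<chi>g)
  then show "integrable M (\<lambda>\<omega>. ctrl f (Suc k) \<omega> $$ (i, j))"
    using step by (subst Bochner_Integration.integrable_cong[OF refl]) auto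
  have "expectation (\<lambda>\<omega>. ctrl f (Suc k) \<omega> $$ (i, j))
      = expectation (\<lambda>\<omega>. ctrl f k \<omega> $$ (i, j) + 1 / block_weight a b * (\<chi> \<omega> * g \<omega>))"
    using step by (intro Bochner_Integration.integral_cong) auto
  also have "\<dots> = mean_ctrl f k $$ (i, j) + 1 / block_weight a b * (expectation \<chi> * expectation g)"
    using int[OF ij] \<chi>g indep_var_lebesgue_integral[OF ind \<chi> g(1)] ij
    by (simp add: mean_ctrl_def)
  also have "\<dots> = mean_ctrl f k $$ (i, j) + 1 / ((frob_norm A)\<^sup>2 * (frob_norm B)\<^sup>2)
      * (block_weight a b * (1 / block_weight a b * grad f (mean_ctrl f k) $$ (i, j)))"
    using expectation_draw_indicator[OF a(1) b(1)] by (simp add: g(2) \<chi>_def[abs_def])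
  also have "block_weight a b * (1 / block_weight a b * grad f (mean_ctrl f k) $$ (i, j))
      = grad f (mean_ctrl f k) $$ (i, j)"
    unfolding block_weight_def using A B coord_Q mean_ctrl_carrier ij a(2) b(2)
    by (intro block_weight_cancel[where m = m and r = r]) (auto simp: residual_def)
  finally show "expectation (\<lambda>\<omega>. ctrl f (Suc k) \<omega> $$ (i, j)) = mean_ctrl f k $$ (i, j)
      + 1 / ((frob_norm A)\<^sup>2 * (frob_norm B)\<^sup>2) * grad f (mean_ctrl f k) $$ (i, j)" .
qed

lemma ctrl_integrable:
  "i \<le> n1 \<Longrightarrow> j \<le> n2 \<Longrightarrow> integrable M (\<lambda>\<omega>. ctrl f k \<omega> $$ (i, j))"
proof (induction k arbitrary: i j)
  case 0
  then show ?case by simp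
next
  case (Suc k)
  then show ?case by (intro ctrl_step(1)) auto
qed

lemma mean_ctrl_Suc:
  "mean_ctrl f (Suc k) = mean_ctrl f k + 1 / ((frob_norm A)\<^sup>2 * (frob_norm B)\<^sup>2)
    \<cdot>\<^sub>m grad f (mean_ctrl f k)"
proof (rule eq_matI)
  let ?c = "1 / ((frob_norm A)\<^sup>2 * (frob_norm B)\<^sup>2)"
  have g: "grad f (mean_ctrl f k) \<in> carrier_mat (n1 + 1) (n2 + 1)"
    using A B by auto
  show "dim_row (mean_ctrl f (Suc k)) = dim_row (mean_ctrl f k + ?c \<cdot>\<^sub>m grad f (mean_ctrl f k))"
    "dim_col (mean_ctrl f (Suc k)) = dim_col (mean_ctrl f k + ?c \<cdot>\<^sub>m grad f (mean_ctrl f k))"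
    using g by (auto simp: mean_ctrl_def)
  fix i j
  assume "i < dim_row (mean_ctrl f k + ?c \<cdot>\<^sub>m grad f (mean_ctrl f k))"
    "j < dim_col (mean_ctrl f k + ?c \<cdot>\<^sub>m grad f (mean_ctrl f k))"
  then have ij: "i \<le> n1" "j \<le> n2" using g by auto
  have "mean_ctrl f (Suc k) $$ (i, j) = expectation (\<lambda>\<omega>. ctrl f (Suc k) \<omega> $$ (i, j))"
    using ij by (simp add: mean_ctrl_def del: rpia.simps)
  also have "\<dots> = mean_ctrl f k $$ (i, j) + ?c * grad f (mean_ctrl f k) $$ (i, j)"
    by (rule ctrl_step(2)[OF ctrl_integrable ij])
  also have "\<dots> = (mean_ctrl f k + ?c \<cdot>\<^sub>m grad f (mean_ctrl f k)) $$ (i, j)"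
    using ij g by (simp del: index_mult_mat)
  finally show "mean_ctrl f (Suc k) $$ (i, j)
    = (mean_ctrl f k + ?c \<cdot>\<^sub>m grad f (mean_ctrl f k)) $$ (i, j)" .
qed

lemma expectation_ctrl_tendsto:
  assumes "full_column_rank A" "full_column_rank B" "i \<le> n1" "j \<le> n2"
  shows "(\<lambda>k. expectation (\<lambda>\<omega>. ctrl f k \<omega> $$ (i, j)))
    \<longlonglongrightarrow> lsq_solution A B (coord f Q) $$ (i, j)"
proof -
  have "(\<lambda>k. mean_ctrl f k $$ (i, j)) \<longlonglongrightarrow> lsq_solution A B (coord f Q) $$ (i, j)"
    using assms by (intro mean_iteration_tendsto[OF A B coord_Q] mean_ctrl_carrier mean_ctrl_Suc) auto
  then show ?thesis using assms by (simp add: mean_ctrl_def)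
qed

lemma expectation_surface:
  "integrable M (\<lambda>\<omega>. surface \<mu> v n1 n2 (iter (\<lambda>l. T l \<omega>) (\<lambda>l. S l \<omega>) k) x y)" (is ?int)
  "expectation (\<lambda>\<omega>. surface \<mu> v n1 n2 (iter (\<lambda>l. T l \<omega>) (\<lambda>l. S l \<omega>) k) x y)
    = (\<Sum>i\<le>n1. \<Sum>j\<le>n2. \<Sum>f\<in>UNIV.
        (\<mu> i x * v j y * expectation (\<lambda>\<omega>. ctrl f k \<omega> $$ (i, j))) *\<^sub>R axis f 1)" (is ?exp)
proof -
  have "has_bochner_integral M (\<lambda>\<omega>. surface \<mu> v n1 n2 (iter (\<lambda>l. T l \<omega>) (\<lambda>l. S l \<omega>) k) x y)
    (\<Sum>i\<le>n1. \<Sum>j\<le>n2. \<Sum>f\<in>UNIV.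
        (\<mu> i x * v j y * expectation (\<lambda>\<omega>. ctrl f k \<omega> $$ (i, j))) *\<^sub>R axis f 1)"
    unfolding surface_eq_sum_coords[OF rpia_carrier[OF P0]]
    by (intro has_bochner_integral_sum has_bochner_integral_scaleR_left
        has_bochner_integral_mult_right has_bochner_integral_integrable ctrl_integrable) auto
  then show ?int ?exp by (auto simp: has_bochner_integral_iff)
qed

end

section \<open>Convergence in expectation\<close>

lemma augmented_mat_carrier:
  assumes "Lu \<in> carrier_mat (n + 1) (n + 1)"
  shows "augmented_mat (collocation_mat \<mu> n x m) reg Lu \<in> carrier_mat (m + 1 + (n + 1)) (n + 1)"
  unfolding augmented_mat_def collocation_mat_def using assms
  by (intro carrier_append_rows) auto

lemma augmented_data_carrier:
  assumes "Q \<in> carrier_mat m p"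
  shows "augmented_data Q r c \<in> carrier_mat (m + r) (p + c)"
  using assms by (auto simp: augmented_data_def)

theorem theorem4p2:
  fixes \<mu> v :: "nat \<Rightarrow> real \<Rightarrow> real"
    and n1 n2 m p t s :: nat
    and x y :: "nat \<Rightarrow> real"
    and Q P0 Qhat Pstar :: "(real ^ 3) mat"
    and reg :: real
    and Lu Lv Ahat Bhat :: "real mat"
    and U V :: "nat \<Rightarrow> nat set"
    and M :: "'w measure"
    and T S :: "nat \<Rightarrow> 'w \<Rightarrow> nat"
    and P :: "nat \<Rightarrow> 'w \<Rightarrow> (real ^ 3) mat"
  assumes "strict_mono_on {..m} x" and "x ` {..m} \<subseteq> {0..1}"
    and "strict_mono_on {..p} y" and "y ` {..p} \<subseteq> {0..1}"
    and "Q \<in> carrier_mat (m + 1) (p + 1)"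
    and "reg \<ge> 0"
    and "indexed_partition U t n1" and "indexed_partition V s n2"
    and "second_difference_mat n1 Lu" and "second_difference_mat n2 Lv"
    and "Ahat = augmented_mat (collocation_mat \<mu> n1 x m) reg Lu"
    and "Bhat = augmented_mat (collocation_mat v n2 y p) reg Lv"
    and "Qhat = augmented_data Q (n1 + 1) (n2 + 1)"
    and "full_column_rank Ahat" and "full_column_rank Bhat"
    and "(m + 1) * (p + 1) > (n1 + 1) * (n2 + 1)"
    and "P0 \<in> carrier_mat (n1 + 1) (n2 + 1)"
    and "prob_space M"
    and "rpia_draws M Ahat Bhat t U s V T S"
    and "P = (\<lambda>k \<omega>. rpia Ahat Bhat Qhat U V P0 (\<lambda>l. T l \<omega>) (\<lambda>l. S l \<omega>) k)"
    and "Pstar = of_coords (n1 + 1) (n2 + 1) (\<lambda>f. lsq_solution Ahat Bhat (coord f Qhat))"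
  shows "(\<forall>f X. is_arg_min (\<lambda>X. (frob_norm (Ahat * X * Bhat\<^sup>T - coord f Qhat))\<^sup>2)
             (\<lambda>X. X \<in> carrier_mat (n1 + 1) (n2 + 1)) X
           \<longleftrightarrow> X = lsq_solution Ahat Bhat (coord f Qhat)) \<and>
         (\<forall>f. \<forall>i\<le>n1. \<forall>j\<le>n2.
            (\<forall>k. integrable M (\<lambda>\<omega>. coord f (P k \<omega>) $$ (i, j))) \<and>
            (\<lambda>k. prob_space.expectation M (\<lambda>\<omega>. coord f (P k \<omega>) $$ (i, j)))
              \<longlonglongrightarrow> lsq_solution Ahat Bhat (coord f Qhat) $$ (i, j)) \<and>
         (\<forall>a\<in>{x 0..x m}. \<forall>b\<in>{y 0..y p}.
            (\<forall>k. integrable M (\<lambda>\<omega>. surface \<mu> v n1 n2 (P k \<omega>) a b)) \<and>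
            (\<lambda>k. prob_space.expectation M (\<lambda>\<omega>. surface \<mu> v n1 n2 (P k \<omega>) a b))
              \<longlonglongrightarrow> surface \<mu> v n1 n2 Pstar a b)"
proof -
  define ma rb where "ma = m + 1 + (n1 + 1)" and "rb = p + 1 + (n2 + 1)"
  have Lu: "Lu \<in> carrier_mat (n1 + 1) (n1 + 1)" and Lv: "Lv \<in> carrier_mat (n2 + 1) (n2 + 1)"
    using assms(9,10) by (simp_all add: second_difference_mat_def)
  have A: "Ahat \<in> carrier_mat ma (n1 + 1)" and B: "Bhat \<in> carrier_mat rb (n2 + 1)"
    unfolding assms(11,12) ma_def rb_def by (intro augmented_mat_carrier Lu Lv)+
  have Q: "Qhat \<in> carrier_mat ma rb"
    unfolding assms(13) ma_def rb_def by (intro augmented_data_carrier assms(5))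
  interpret prob_space M by fact
  interpret rpia_process Ahat Bhat Qhat P0 U V ma rb n1 n2 t s M T S
    by unfold_locales (fact A B Q assms)+
  have P: "P k \<omega> = iter (\<lambda>l. T l \<omega>) (\<lambda>l. S l \<omega>) k" for k \<omega>
    by (simp add: assms(20))
  have min: "is_arg_min (\<lambda>X. (frob_norm (Ahat * X * Bhat\<^sup>T - coord f Qhat))\<^sup>2)
      (\<lambda>X. X \<in> carrier_mat (n1 + 1) (n2 + 1)) X \<longleftrightarrow> X = lsq_solution Ahat Bhat (coord f Qhat)"
    for f X
    using assms(14,15) by (intro lsq_solution_is_arg_min_iff[OF A B coord_Q]) auto
  have Pstar: "Pstar \<in> carrier_mat (n1 + 1) (n2 + 1)"
    by (simp add: assms(21) of_coords_def)
  have lim: "(\<lambda>k. expectation (\<lambda>\<omega>. surface \<mu> v n1 n2 (P k \<omega>) a b))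
      \<longlonglongrightarrow> surface \<mu> v n1 n2 Pstar a b" for a b
  proof -
    have "coord f Pstar $$ (i, j) = lsq_solution Ahat Bhat (coord f Qhat) $$ (i, j)"
      if "i \<le> n1" "j \<le> n2" for f i j
      using that by (simp add: assms(21) coord_of_coords)
    then show ?thesis
      unfolding P expectation_surface(2) surface_eq_sum_coords[OF Pstar]
      by (intro tendsto_sum tendsto_scaleR tendsto_mult tendsto_const)
        (simp add: expectation_ctrl_tendsto assms(14,15))
  qed
  show ?thesis
    using min lim ctrl_integrable expectation_ctrl_tendsto[OF assms(14,15)] expectation_surface(1)
    by (simp add: P)
qed

end
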